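(* Let $F\in\mathcal L_n$ be a real function with $\|F\|_{\mathsf E}\le 1$. Then $F$ is an extremal function of the extremal problem (for $\mathsf E$, $D_n^\infty$, $x_*$) if and only if $F$ has a maximal alternation set, i.e. an alternation set consisting of $n+1$ points. Moreover, in that case $F$ is the unique extremal function.
   Context: Let $\mathsf E\subset\overline{\mathbb R}=\mathbb R\cup\{\infty\}$ be a compact proper subset containing infinitely many points; connected components of $\overline{\mathbb R}\setminus\mathsf E$ are called gaps. A sequence $(t_0,\dots,t_m)$, $m\ge2$, in $\overline{\mathbb R}$ is cyclically ordered if it has no repetitions and there is $f\in\mathrm{PSL}(2,\mathbb R)$ (orientation-preserving Möbius maps preserving $\overline{\mathbb R}$) with $f(t_0)=\infty$ and $f(t_1)<\dots<f(t_m)$. For distinct $a,b\in\overline{\mathbb R}$: $(a,b)=\{c:(a,c,b)\text{ cyclically ordered}\}$, $[a,b)=(a,b)\cup\{a\}$. A divisor is a finitely supported function $D:\overline{\mathbb C}\to\mathbb Z$; it is integral if $D\ge 0$, and $\deg D=\sum_z D(z)$. For a rational function $f$, $(f)_\infty$ denotes its polar divisor (order of each pole, including at $\infty$) and $(f)_0$ its zero divisor, with the convention $(f)_\infty=(f)_0=0$ for constant $f$. For integral $D$, $\mathcal L(D)=\{f\text{ rational}:(f)_\infty\le D\}$. For $\mathbf c\in\overline{\mathbb R}$ put $r(z,\mathbf c)=1/(\mathbf c-z)$ if $\mathbf c\ne\infty$ and $r(z,\infty)=z$. Fix $n\ge1$, an integral divisor $D_n^\infty$ of degree $n$ with support in $\overline{\mathbb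 R}\setminus\mathsf E$, and $x_*\in\overline{\mathbb R}\setminus\mathsf E$; let $d_n=D_n^\infty(x_* )$, $\mathcal L_n=\mathcal L(D_n^\infty)$, $\|F\|_{\mathsf E}=\sup_{\mathsf E}|F|$. The extremal problem is $$m_n(x_* )=\sup\Big\{\Re\lim_{x\to x_*}\frac{F(x)}{r(x,x_* )^{d_n}}: F\in\mathcal L_n,\ \|F\|_{\mathsf E}\le1\Big\},$$ and an extremal function is an $F$ attaining this supremum. A function $F$ is real if $F(\bar z)=\overline{F(z)}$. The sign function is $S_n(x)=\sum_{\mathbf c\in\overline{\mathbb R}\setminus\{x_*\}}D_n^\infty(\mathbf c)\chi_{[x_*,\mathbf c)}(x)$. For real $F\in\mathcal L_n$ with $\|F\|_{\mathsf E}\le 1$, an alternation set is a set of distinct points $x_1,\dots,x_m\in\mathsf E$ such that $(x_*,x_1,\dots,x_m)$ is cyclically ordered and $F(x_j)=(-1)^{m-j-S_n(x_j)}$ for $j=1,\dots,m$; it is maximal if $m=n+1$. *)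

theory Defs
  imports "HOL-Analysis.Analysis" "HOL-Computational_Algebra.Computational_Algebra"
begin

datatype rs = Fin complex | Infty

definition xreal_pts :: "rs set" where
  "xreal_pts = range (\<lambda>x::real. Fin (complex_of_real x)) \<union> {Infty}"

text \<open>Topology of the extended real line, transported along the Cayley map
  onto the unit circle (a homeomorphism of the extended real line onto the circle).\<close>
fun cayley :: "rs \<Rightarrow> complex" where
  "cayley (Fin z) = (z - \<i>) / (z + \<i>)"
| "cayley Infty = 1"

definition xreal_compact :: "rs set \<Rightarrow> bool" where
  "xreal_compact E \<longleftrightarrow> E \<subseteq> xreal_pts \<and> compact (cayley ` E)"

fun mobius :: "real \<Rightarrow> real \<Rightarrow> real \<Rightarrow> real \<Rightarrow> rs \<Rightarrow> rs" where
  "mobius a b c d (Fin z) =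
     (if of_real c * z + of_real d = 0 then Infty
      else Fin ((of_real a * z + of_real b) / (of_real c * z + of_real d)))"
| "mobius a b c d Infty = (if c = 0 then Infty else Fin (of_real a / of_real c))"

definition PSL2R :: "(rs \<Rightarrow> rs) set" where
  "PSL2R = {mobius a b c d | a b c d. a * d - b * c = 1}"

definition xr_less :: "rs \<Rightarrow> rs \<Rightarrow> bool" where
  "xr_less u v \<longleftrightarrow> (\<exists>x y::real. u = Fin (of_real x) \<and> v = Fin (of_real y) \<and> x < y)"

definition cyc_ordered :: "rs list \<Rightarrow> bool" where
  "cyc_ordered ts \<longleftrightarrow> length ts \<ge> 3 \<and> set ts \<subseteq> xreal_pts \<and> distinct ts \<and>
     (\<exists>f\<in>PSL2R. f (hd ts) = Infty \<and> sorted_wrt xr_less (map f (tl ts)))"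

definition xr_oo :: "rs \<Rightarrow> rs \<Rightarrow> rs set" where
  "xr_oo a b = {c. cyc_ordered [a, c, b]}"

definition xr_co :: "rs \<Rightarrow> rs \<Rightarrow> rs set" where
  "xr_co a b = xr_oo a b \<union> {a}"

text \<open>Rational functions: the fraction field of C[z]. A reduced (coprime) representation p/q; all notions below are
  independent of the choice of the representation.\<close>
type_synonym ratfun = "complex poly fract"

definition reduced_rep :: "ratfun \<Rightarrow> complex poly \<times> complex poly" where
  "reduced_rep F = (SOME (p, q). q \<noteq> 0 \<and> coprime p q \<and> F = Fract p q)"
definition rnum :: "ratfun \<Rightarrow> complex poly" where "rnum F = fst (reduced_rep F)"
definition rden :: "ratfun \<Rightarrow> complex poly" where "rden F = snd (reduced_rep F)"

text \<open>Value of a rational function at a point of the sphere (value at poles irrelevant, set to 0).\<close>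
fun rval :: "ratfun \<Rightarrow> rs \<Rightarrow> complex" where
  "rval F (Fin z) = poly (rnum F) z / poly (rden F) z"
| "rval F Infty =
     (if degree (rnum F) = degree (rden F) then lead_coeff (rnum F) / lead_coeff (rden F)
      else 0)"

fun polar_div :: "ratfun \<Rightarrow> rs \<Rightarrow> nat" where
  "polar_div F (Fin z) = order z (rden F)"
| "polar_div F Infty = degree (rnum F) - degree (rden F)"

definition divisor :: "(rs \<Rightarrow> int) \<Rightarrow> bool" where
  "divisor D \<longleftrightarrow> finite {z. D z \<noteq> 0}"

definition integral_div :: "(rs \<Rightarrow> int) \<Rightarrow> bool" where
  "integral_div D \<longleftrightarrow> divisor D \<and> (\<forall>z. D z \<ge> 0)"

definition div_deg :: "(rs \<Rightarrow> int) \<Rightarrow> int" where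
  "div_deg D = (\<Sum>z\<in>{z. D z \<noteq> 0}. D z)"

definition LL :: "(rs \<Rightarrow> int) \<Rightarrow> ratfun set" where
  "LL D = {F. \<forall>z. int (polar_div F z) \<le> D z}"

definition real_ratfun :: "ratfun \<Rightarrow> bool" where
  "real_ratfun F \<longleftrightarrow> (\<forall>z. rval F (Fin (cnj z)) = cnj (rval F (Fin z)))"

definition norm_le1 :: "rs set \<Rightarrow> ratfun \<Rightarrow> bool" where
  "norm_le1 E F \<longleftrightarrow> (\<forall>x\<in>E. cmod (rval F x) \<le> 1)"

text \<open>The limit of F(x)/r(x,c)^d as x tends to c, with r(x,c) = 1/(c-x), r(x,\<infinity>) = x.\<close>
fun lead_lim :: "ratfun \<Rightarrow> rs \<Rightarrow> nat \<Rightarrow> complex" where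
  "lead_lim F (Fin c) d = Lim (at c) (\<lambda>z. rval F (Fin z) * (c - z) ^ d)"
| "lead_lim F Infty d = Lim at_infinity (\<lambda>z. rval F (Fin z) / z ^ d)"

definition admissible :: "rs set \<Rightarrow> (rs \<Rightarrow> int) \<Rightarrow> ratfun \<Rightarrow> bool" where
  "admissible E D F \<longleftrightarrow> F \<in> LL D \<and> norm_le1 E F"

definition m_val :: "rs set \<Rightarrow> (rs \<Rightarrow> int) \<Rightarrow> rs \<Rightarrow> real" where
  "m_val E D xs = (SUP F\<in>{F. admissible E D F}. Re (lead_lim F xs (nat (D xs))))"

definition extremal :: "rs set \<Rightarrow> (rs \<Rightarrow> int) \<Rightarrow> rs \<Rightarrow> ratfun \<Rightarrow> bool" where
  "extremal E D xs F \<longleftrightarrow> admissible E D F \<and>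
     (\<forall>G. admissible E D G \<longrightarrow>
        Re (lead_lim G xs (nat (D xs))) \<le> Re (lead_lim F xs (nat (D xs))))"

definition sign_fun :: "(rs \<Rightarrow> int) \<Rightarrow> rs \<Rightarrow> rs \<Rightarrow> int" where
  "sign_fun D xs x = (\<Sum>c\<in>{c. D c \<noteq> 0} - {xs}. D c * (if x \<in> xr_co xs c then 1 else 0))"

definition alternation_set :: "rs set \<Rightarrow> (rs \<Rightarrow> int) \<Rightarrow> rs \<Rightarrow> ratfun \<Rightarrow> rs list \<Rightarrow> bool" where
  "alternation_set E D xs F xl \<longleftrightarrow>
     set xl \<subseteq> E \<and> distinct xl \<and> cyc_ordered (xs # xl) \<and>
     (\<forall>j\<in>{1..length xl}.
        rval F (xl ! (j - 1)) =
          (-1::complex) powi (int (length xl) - int j - sign_fun D xs (xl ! (j - 1))))"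

end

theory Submission
  imports Defs "HOL-Computational_Algebra.Field_as_Ring"
begin

text \<open>A Moebius map sending \<open>xs\<close> to \<open>\<infinity>\<close> identifies the functions with polar divisor at most \<open>D\<close>
  with the quotients \<open>p / W\<close>, where \<open>deg p \<le> n\<close> and \<open>W\<close> is a fixed monic real polynomial without zeros on
  the image \<open>K\<close> of \<open>E\<close>, and the extremal problem asks for the largest \<open>n\<close>-th coefficient of \<open>p\<close>
  subject to \<open>\<bar>p\<bar> \<le> \<bar>W\<bar>\<close> on \<open>K\<close>. The sign function is the number of sign changes of
  \<open>W\<close> to the right of a point, so alternation sets become Chebyshev alternation of \<open>p / \<bar>W\<bar>\<close>.
  If \<open>p\<close> alternates at \<open>n + 1\<close> points, Lagrange interpolation at these points expresses the \<open>n\<close>-th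
  coefficient with weights of alternating sign, which gives extremality and uniqueness. If a real \<open>p\<close>
  does not, a monic real polynomial of degree \<open>n\<close> has the sign opposite to \<open>p\<close> wherever
  \<open>\<bar>p\<bar> = \<bar>W\<bar>\<close>, and adding a small multiple of it increases the \<open>n\<close>-th coefficient.\<close>

section \<open>Weighted Chebyshev polynomials on compact subsets of the line\<close>

text \<open>The sum is the leading coefficient in the Lagrange interpolation formula at the
  \<open>n + 1\<close> nodes in \<open>S\<close>, and the degree bound makes \<open>g\<close> its
  own interpolant.\<close>

lemma coeff_eq_divided_difference:
  fixes g :: "'a::field poly"
  assumes S: "finite S" "card S = Suc n" and deg: "degree g \<le> n"
  shows "coeff g n = (\<Sum>x\<in>S. poly g x / (\<Prod>y\<in>S - {x}. x - y))"
proof -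
  define L where "L x = (\<Prod>y\<in>S - {x}. [:-y, 1:])" for x
  define h where "h = (\<Sum>x\<in>S. smult (poly g x / (\<Prod>y\<in>S - {x}. x - y)) (L x))"
  have degL: "degree (L x) = n" and leadL: "coeff (L x) n = 1" if "x \<in> S" for x
  proof -
    show *: "degree (L x) = n"
      unfolding L_def using S that by (subst degree_prod_sum_eq) auto
    have "lead_coeff (L x) = 1" by (simp add: L_def lead_coeff_prod)
    with * show "coeff (L x) n = 1" by simp
  qed
  have degh: "degree h \<le> n"
    unfolding h_def using S degL by (intro degree_sum_le) (auto intro: order.trans[OF degree_smult_le])
  have "poly h z = poly g z" if z: "z \<in> S" for z
  proof -
    have "poly (L x) z = (if x = z then \<Prod>y\<in>S - {z}. z - y else 0)" if "x \<in> S" for x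
      using S z that by (auto simp: L_def poly_prod prod_zero_iff)
    then have "poly h z = (\<Sum>x\<in>S. if x = z then poly g z else 0)"
      unfolding h_def poly_sum poly_smult
      using S by (intro sum.cong) auto
    then show ?thesis using S z by simp
  qed
  then have "h = g"
    by (intro poly_eqI_degree[of S]) (use S degh deg in auto)
  moreover have "coeff h n = (\<Sum>x\<in>S. poly g x / (\<Prod>y\<in>S - {x}. x - y))"
    by (simp add: h_def coeff_sum leadL)
  ultimately show ?thesis by simp
qed

text \<open>Exactly the \<open>n - j\<close> factors with \<open>k > j\<close> are negative. These
  products are the denominators of the Lagrange weights, whose signs therefore alternate.\<close>

lemma prod_diff_strict_mono_sign:
  fixes y :: "nat \<Rightarrow> real"
  assumes "\<And>i j. i < j \<Longrightarrow> j \<le> n \<Longrightarrow> y i < y j" and "j \<le> n"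
  shows "(\<Prod>k\<in>{..n} - {j}. y j - y k) = (-1) ^ (n - j) * \<bar>\<Prod>k\<in>{..n} - {j}. y j - y k\<bar>"
    and "(\<Prod>k\<in>{..n} - {j}. y j - y k) \<noteq> 0"
proof -
  have split: "{..n} - {j} = {..<j} \<union> {j<..n}" using assms(2) by auto
  have "(\<Prod>k\<in>{j<..n}. y j - y k) = (\<Prod>k\<in>{j<..n}. - 1 * \<bar>y j - y k\<bar>)"
    using assms by (intro prod.cong) (auto simp: abs_if dest: assms(1))
  also have "\<dots> = (-1) ^ (n - j) * (\<Prod>k\<in>{j<..n}. \<bar>y j - y k\<bar>)"
    by (simp only: prod.distrib) simp
  finally have hi: "(\<Prod>k\<in>{j<..n}. y j - y k) = (-1) ^ (n - j) * (\<Prod>k\<in>{j<..n}. \<bar>y j - y k\<bar>)" .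
  have lo: "(\<Prod>k\<in>{..<j}. y j - y k) = (\<Prod>k\<in>{..<j}. \<bar>y j - y k\<bar>)"
    using assms by (intro prod.cong) (auto simp: abs_if dest: assms(1))
  have dj: "{..<j} \<inter> {j<..n} = {}" by auto
  show "(\<Prod>k\<in>{..n} - {j}. y j - y k) = (-1) ^ (n - j) * \<bar>\<Prod>k\<in>{..n} - {j}. y j - y k\<bar>"
    unfolding split abs_prod using dj by (simp add: prod.union_disjoint hi lo)
  show "(\<Prod>k\<in>{..n} - {j}. y j - y k) \<noteq> 0"
    using assms(1)[of j] assms(1)[of _ j] assms(2)
    by (auto simp: prod_zero_iff) (metis less_irrefl nat_neq_iff)
qed

text \<open>In the divided-difference formula the sign \<open>(-1) ^ (n - j)\<close> of each weight
  cancels against that of \<open>p\<close> at \<open>y j\<close>, so \<open>p\<close> maximises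
  every term separately. Equality of the sums forces equality term by term, hence agreement with
  \<open>p\<close> at \<open>n + 1\<close> points.\<close>

lemma alternation_imp_coeff_le:
  fixes p g :: "complex poly" and y :: "nat \<Rightarrow> real" and w :: "real \<Rightarrow> real"
  assumes mono: "\<And>i j. i < j \<Longrightarrow> j \<le> n \<Longrightarrow> y i < y j"
    and degp: "degree p \<le> n" and degg: "degree g \<le> n"
    and alt: "\<And>j. j \<le> n \<Longrightarrow> poly p (of_real (y j)) = (-1) ^ (n - j) * of_real \<bar>w (y j)\<bar>"
    and bound: "\<And>j. j \<le> n \<Longrightarrow> cmod (poly g (of_real (y j))) \<le> \<bar>w (y j)\<bar>"
  shows "Re (coeff g n) \<le> Re (coeff p n)"
    and "Re (coeff g n) = Re (coeff p n) \<Longrightarrow> g = p"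
proof -
  define V where "V j = \<bar>\<Prod>k\<in>{..n} - {j}. y j - y k\<bar>" for j
  have inj: "inj_on (\<lambda>j. complex_of_real (y j)) {..n}"
    by (rule inj_onI) (metis atMost_iff less_irrefl mono nat_neq_iff of_real_eq_iff)
  have V: "V j > 0" if "j \<le> n" for j
    using prod_diff_strict_mono_sign(2)[of n y j] mono that by (simp add: V_def)
  have nodes: "coeff f n = (\<Sum>j\<le>n. (-1) ^ (n - j) * poly f (of_real (y j)) / of_real (V j))"
    if "degree f \<le> n" for f :: "complex poly"
  proof -
    have "coeff f n = (\<Sum>x\<in>(\<lambda>j. complex_of_real (y j)) ` {..n}.
        poly f x / (\<Prod>z\<in>(\<lambda>j. complex_of_real (y j)) ` {..n} - {x}. x - z))"
      using that inj by (intro coeff_eq_divided_difference) (auto simp: card_image)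
    also have "\<dots> = (\<Sum>j\<le>n. poly f (of_real (y j)) /
        (\<Prod>z\<in>(\<lambda>j. complex_of_real (y j)) ` {..n} - {of_real (y j)}. of_real (y j) - z))"
      using inj by (subst sum.reindex) auto
    also have "\<dots> = (\<Sum>j\<le>n. (-1) ^ (n - j) * poly f (of_real (y j)) / of_real (V j))"
    proof (intro sum.cong refl)
      fix j assume j: "j \<in> {..n}"
      have "(\<lambda>j. complex_of_real (y j)) ` {..n} - {of_real (y j)} =
          (\<lambda>j. complex_of_real (y j)) ` ({..n} - {j})"
        using inj_on_image_set_diff[OF inj, of "{..n}" "{j}"] j by auto
      then have "(\<Prod>z\<in>(\<lambda>j. complex_of_real (y j)) ` {..n} - {of_real (y j)}. of_real (y j) - z)
          = (\<Prod>k\<in>{..n} - {j}. complex_of_real (y j) - of_real (y k))"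
        using inj_on_subset[OF inj, of "{..n} - {j}"] by (simp add: prod.reindex)
      also have "\<dots> = of_real (\<Prod>k\<in>{..n} - {j}. y j - y k)" by simp
      also have "\<dots> = (-1) ^ (n - j) * of_real (V j)"
        unfolding V_def using mono j
        by (subst prod_diff_strict_mono_sign(1)[of n y j]) auto
      finally show "poly f (of_real (y j)) /
          (\<Prod>z\<in>(\<lambda>j. complex_of_real (y j)) ` {..n} - {of_real (y j)}. of_real (y j) - z)
          = (-1) ^ (n - j) * poly f (of_real (y j)) / of_real (V j)"
        using minus_one_power_iff[of "n - j", where 'a=complex] by auto
    qed
    finally show ?thesis .
  qed
  define a where "a j = Re ((-1) ^ (n - j) * poly g (of_real (y j)))" for j
  have cmod_eq: "cmod ((-1) ^ (n - j) * poly g (of_real (y j))) = cmod (poly g (of_real (y j)))" for j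
    by (simp add: norm_mult norm_power)
  have a_le: "a j \<le> \<bar>w (y j)\<bar>" if "j \<le> n" for j
    using complex_Re_le_cmod[of "(-1) ^ (n - j) * poly g (of_real (y j))"] bound[OF that]
    unfolding a_def cmod_eq by linarith
  have Re_div: "Re (z / of_real r) = Re z / r" for z and r :: real
    by simp
  have g_eq: "Re (coeff g n) = (\<Sum>j\<le>n. a j / V j)"
    unfolding nodes[OF degg] Re_sum a_def Re_div ..
  have p_eq: "Re (coeff p n) = (\<Sum>j\<le>n. \<bar>w (y j)\<bar> / V j)"
    unfolding nodes[OF degp] Re_sum Re_div
  proof (intro sum.cong refl)
    fix j assume "j \<in> {..n}"
    then have "(-1) ^ (n - j) * poly p (of_real (y j)) = of_real \<bar>w (y j)\<bar>"
      using alt[of j] by (simp flip: mult.assoc power_mult_distrib)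
    then show "Re ((-1) ^ (n - j) * poly p (of_real (y j))) / V j = \<bar>w (y j)\<bar> / V j" by simp
  qed
  show "Re (coeff g n) \<le> Re (coeff p n)"
    unfolding g_eq p_eq using a_le V by (intro sum_mono divide_right_mono) (auto intro: less_imp_le)
  assume "Re (coeff g n) = Re (coeff p n)"
  then have "(\<Sum>j\<le>n. \<bar>w (y j)\<bar> / V j - a j / V j) = 0"
    by (simp add: g_eq p_eq sum_subtractf)
  moreover have "0 \<le> \<bar>w (y j)\<bar> / V j - a j / V j" if "j \<le> n" for j
    using divide_right_mono[OF a_le[OF that], of "V j"] V[OF that] by simp
  ultimately have zero: "\<bar>w (y j)\<bar> / V j - a j / V j = 0" if "j \<le> n" for j
    using that by (subst (asm) sum_nonneg_eq_0_iff) auto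
  have "poly g (of_real (y j)) = poly p (of_real (y j))" if j: "j \<le> n" for j
  proof -
    \<comment> \<open>The real part already exhausts the bound on the modulus, which leaves no room
      for an imaginary part.\<close>
    let ?z = "(-1) ^ (n - j) * poly g (of_real (y j))"
    have Re: "Re ?z = \<bar>w (y j)\<bar>" using zero[OF j] V[OF j] by (simp add: a_def)
    have "(Re ?z)\<^sup>2 + (Im ?z)\<^sup>2 \<le> \<bar>w (y j)\<bar>\<^sup>2"
      using bound[OF j] power_mono[of "cmod ?z" "\<bar>w (y j)\<bar>" 2]
      by (simp only: cmod_eq cmod_power2[symmetric]) simp
    then have "Im ?z = 0" unfolding Re by simp
    with Re have "?z = of_real \<bar>w (y j)\<bar>" by (simp add: complex_eq_iff)
    then have "(-1) ^ (n - j) * ?z = poly p (of_real (y j))" using alt[OF j] by simp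
    then show ?thesis by (simp flip: mult.assoc power_mult_distrib)
  qed
  then show "g = p"
    by (intro poly_eqI_degree[of "(\<lambda>j. complex_of_real (y j)) ` {..n}"])
       (use inj degp degg in \<open>auto simp: card_image\<close>)
qed

text \<open>Induction on \<open>k\<close> that builds the chain greedily from the right: the maximum
  \<open>t\<close> of \<open>A\<close> is its last point, and the rest is sought left of
  \<open>t\<close> with \<open>A\<close> and \<open>B\<close> exchanged. If that search fails, one
  new root just right of \<open>t\<close> restores the signs. Positivity beyond \<open>s\<close> is
  carried along because, with \<open>t\<close> in the role of \<open>s\<close>, it fixes the sign at
  the points of \<open>B\<close> right of \<open>t\<close>.\<close>

lemma alternating_points_or_separating_polynomial:
  fixes A B :: "real set"
  assumes "compact A" "compact B" "A \<inter> B = {}" "\<forall>a\<in>A. a < s"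
  shows "(\<exists>y :: nat \<Rightarrow> real. (\<forall>i j. i < j \<longrightarrow> j \<le> k \<longrightarrow> y i < y j) \<and>
            (\<forall>j\<le>k. y j \<in> (if even (k - j) then A else B))) \<or>
         (\<exists>R :: real poly. degree R = k \<and> lead_coeff R = 1 \<and> (\<forall>a\<in>A. poly R a < 0) \<and>
            (\<forall>b\<in>B. poly R b > 0) \<and> (\<forall>x\<ge>s. poly R x > 0))"
  using assms
proof (induction k arbitrary: A B s)
  case 0
  show ?case
  proof (cases "A = {}")
    case True
    then show ?thesis by (intro disjI2 exI[of _ 1]) auto
  next
    case False
    then obtain a where "a \<in> A" by auto
    then show ?thesis by (intro disjI1 exI[of _ "\<lambda>_. a"]) auto
  qed
next
  case (Suc k)
  show ?case
  proof (cases "A = {}")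
    case True
    have "bdd_below (insert s B)"
      using Suc.prems(2) by (simp add: compact_imp_bounded bounded_imp_bdd_below)
    then obtain m where "\<And>x. x \<in> insert s B \<Longrightarrow> m \<le> x" by (auto simp: bdd_below_def)
    then have m: "m \<le> s" "\<And>b. b \<in> B \<Longrightarrow> m \<le> b" by auto
    \<comment> \<open>Without points of \<open>A\<close> nothing has to be negative, so all roots
      can sit at \<open>m - 1\<close>, left of \<open>B\<close> and of \<open>s\<close>.\<close>
    define R where "R = [:1 - m, 1:] ^ Suc k"
    have "poly R x > 0" if "x \<ge> m" for x
      unfolding R_def poly_power using that by (intro zero_less_power) simp
    moreover have "degree R = Suc k"
      unfolding R_def by (simp add: degree_power_eq del: power_Suc)
    moreover have "lead_coeff R = 1" unfolding R_def lead_coeff_power by simp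
    ultimately show ?thesis
      using m True by (intro disjI2 exI[of _ R]) (auto intro: order.trans)
  next
    case False
    then obtain t where t: "t \<in> A" "\<And>a. a \<in> A \<Longrightarrow> a \<le> t"
      using compact_attains_sup[of A] Suc.prems(1) by auto
    define B' where "B' = B \<inter> {..t}"
    have tB: "t \<notin> B" using t Suc.prems(3) by auto
    have "compact B'" unfolding B'_def using Suc.prems(2) by (intro compact_Int_closed) auto
    moreover have "b < t" if "b \<in> B'" for b
      using that tB unfolding B'_def by (cases "b = t") auto
    \<comment> \<open>The induction hypothesis is used with \<open>B'\<close> in the role of
      \<open>A\<close>, \<open>A\<close> in the role of \<open>B\<close> and \<open>t\<close> in the
      role of \<open>s\<close>. The last point of the shorter chain lies in \<open>B'\<close>, hence
      left of \<open>t\<close>.\<close>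
    ultimately consider
      (alt) y :: "nat \<Rightarrow> real" where "\<And>i j. i < j \<Longrightarrow> j \<le> k \<Longrightarrow> y i < y j"
        "\<And>j. j \<le> k \<Longrightarrow> y j \<in> (if even (k - j) then B' else A)"
    | (sep) R :: "real poly" where "degree R = k" "lead_coeff R = 1" "\<forall>a\<in>B'. poly R a < 0"
        "\<forall>b\<in>A. poly R b > 0" "\<forall>x\<ge>t. poly R x > 0"
      using Suc.IH[of B' A t] Suc.prems(1,3) unfolding B'_def by blast
    then show ?thesis
    proof cases
      case alt
      define y' where "y' j = (if j \<le> k then y j else t)" for j
      have last: "y j < t" if "j \<le> k" for j
      proof -
        have "y k < t"
          using alt(2)[of k] \<open>\<And>b. b \<in> B' \<Longrightarrow> b < t\<close> by simp
        with alt(1)[of j k] that show ?thesis by (cases "j = k") auto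
      qed
      have "y' i < y' j" if "i < j" "j \<le> Suc k" for i j
        using that alt(1)[of i j] last[of i] by (auto simp: y'_def)
      moreover have "y' j \<in> (if even (Suc k - j) then A else B)" if "j \<le> Suc k" for j
      proof (cases "j \<le> k")
        case True
        then show ?thesis using alt(2)[of j] by (auto simp: y'_def Suc_diff_le B'_def split: if_splits)
      next
        case False
        then show ?thesis using that t by (auto simp: y'_def)
      qed
      ultimately show ?thesis by (intro disjI1 exI[of _ y']) auto
    next
      case sep
      have ts: "t < s" using Suc.prems(4) t by auto
      \<comment> \<open>No point of \<open>B\<close> lies strictly between \<open>t\<close> and
        \<open>u\<close>, and \<open>u\<close> does not exceed \<open>s\<close>, so an extra root
        \<open>z\<close> in between separates \<open>A\<close> from the part of \<open>B\<close>
        right of \<open>t\<close>.\<close>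
      obtain u where u: "t < u" "\<And>b. b \<in> B \<Longrightarrow> t < b \<Longrightarrow> u \<le> b" "u \<le> s"
      proof (cases "B \<inter> {t..} = {}")
        case True
        then show ?thesis using ts that[of s] by force
      next
        case False
        have "compact (B \<inter> {t..})" using Suc.prems(2) by (intro compact_Int_closed) auto
        then obtain b where b: "b \<in> B" "b \<ge> t" "\<And>x. x \<in> B \<Longrightarrow> x \<ge> t \<Longrightarrow> b \<le> x"
          using compact_attains_inf[OF _ False] by auto
        then have "t < b" using tB by (cases "b = t") auto
        then show ?thesis using b ts that[of "min b s"] by (auto simp: min_le_iff_disj)
      qed
      define z where "z = (t + u) / 2"
      have z: "t < z" "z < u" using u by (auto simp: z_def)
      define R' where "R' = R * [:-z, 1:]"
      have R': "poly R' x = poly R x * (x - z)" for x by (simp add: R'_def algebra_simps)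
      have "R \<noteq> 0" using sep(2) by auto
      then have "degree R' = Suc k"
        using sep(1) unfolding R'_def by (simp add: degree_mult_eq del: mult_pCons_right)
      moreover have "lead_coeff R' = 1"
        using sep(2) unfolding R'_def lead_coeff_mult by simp
      moreover have "poly R' a < 0" if "a \<in> A" for a
        unfolding R' using that sep(4) t z by (intro mult_pos_neg) force+
      moreover have "poly R' b > 0" if "b \<in> B" for b
      proof (cases "b \<le> t")
        case True
        then show ?thesis unfolding R' using that sep(3) z by (intro mult_neg_neg) (auto simp: B'_def)
      next
        case False
        then show ?thesis unfolding R' using that sep(5) z u(2)[of b] by (intro mult_pos_pos) auto
      qed
      moreover have "poly R' x > 0" if "x \<ge> s" for x
        unfolding R' using that sep(5) ts u z by (intro mult_pos_pos) auto
      ultimately show ?thesis by blast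
    qed
  qed
qed

text \<open>If no such \<open>\<epsilon>\<close> existed, a limit point of violations for \<open>\<epsilon> = 1 / k\<close> would satisfy
  \<open>\<bar>u\<bar> = 1\<close> and \<open>u * v \<ge> 0\<close>.\<close>

lemma perturbation_decreases_norm:
  fixes u v :: "'a::metric_space \<Rightarrow> real"
  assumes K: "compact K" and u: "continuous_on K u" and v: "continuous_on K v"
    and le: "\<And>x. x \<in> K \<Longrightarrow> \<bar>u x\<bar> \<le> 1"
    and neg: "\<And>x. x \<in> K \<Longrightarrow> \<bar>u x\<bar> = 1 \<Longrightarrow> u x * v x < 0"
  obtains \<epsilon> where "\<epsilon> > 0" "\<And>x. x \<in> K \<Longrightarrow> \<bar>u x + \<epsilon> * v x\<bar> \<le> 1"
proof (rule ccontr)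
  assume "\<not> thesis"
  with that have "\<exists>x\<in>K. \<bar>u x + \<epsilon> * v x\<bar> > 1" if "\<epsilon> > 0" for \<epsilon> :: real
    using that by (meson not_le)
  then have "\<exists>x\<in>K. \<bar>u x + inverse (real (Suc k)) * v x\<bar> > 1" for k by simp
  then obtain x where x: "\<And>k. x k \<in> K" "\<And>k. \<bar>u (x k) + inverse (real (Suc k)) * v (x k)\<bar> > 1"
    by metis
  then obtain l r where l: "l \<in> K" and r: "strict_mono r" and lim: "(x \<circ> r) \<longlonglongrightarrow> l"
    using K[unfolded compact_def] by blast
  have ul: "(\<lambda>k. u (x (r k))) \<longlonglongrightarrow> u l"
    using continuous_on_tendsto_compose[OF u lim l] x(1) by (simp add: o_def)
  have vl: "(\<lambda>k. v (x (r k))) \<longlonglongrightarrow> v l"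
    using continuous_on_tendsto_compose[OF v lim l] x(1) by (simp add: o_def)
  have e0: "(\<lambda>k. inverse (real (Suc (r k)))) \<longlonglongrightarrow> 0"
    using LIMSEQ_subseq_LIMSEQ[OF LIMSEQ_inverse_real_of_nat r] by (simp add: o_def)
  have "(\<lambda>k. \<bar>u (x (r k)) + inverse (real (Suc (r k))) * v (x (r k))\<bar>) \<longlonglongrightarrow> \<bar>u l + 0 * v l\<bar>"
    by (intro tendsto_intros ul vl e0)
  then have "1 \<le> \<bar>u l + 0 * v l\<bar>"
    using x(2) by (intro LIMSEQ_le_const) (auto intro: less_imp_le)
  with le[OF l] have ul1: "\<bar>u l\<bar> = 1" by simp
  have "(\<lambda>k. 2 * u (x (r k)) * v (x (r k)) + inverse (real (Suc (r k))) * (v (x (r k)))\<^sup>2)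
      \<longlonglongrightarrow> 2 * u l * v l + 0 * (v l)\<^sup>2"
    by (intro tendsto_intros ul vl e0)
  \<comment> \<open>Squaring the violated bound, using that the square of \<open>u\<close> is at
    most 1 and dividing by the positive factor gives this inequality, whose limit contradicts
    \<open>neg\<close>.\<close>
  moreover have "2 * u (x k) * v (x k) + inverse (real (Suc k)) * (v (x k))\<^sup>2 \<ge> 0" for k
  proof -
    define e where "e = inverse (real (Suc k))"
    have e: "e > 0" by (simp add: e_def)
    have "\<bar>u (x k) + e * v (x k)\<bar>\<^sup>2 > 1"
      using x(2)[of k] unfolding e_def by (intro one_less_power) auto
    moreover have "(u (x k))\<^sup>2 \<le> 1" using le[OF x(1)[of k]] abs_square_le_1 by blast
    ultimately have "e * (2 * u (x k) * v (x k) + e * (v (x k))\<^sup>2) > 0"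
      by (simp add: power2_eq_square algebra_simps)
    then show ?thesis using e unfolding e_def[symmetric] by (simp add: zero_less_mult_iff)
  qed
  ultimately have "0 \<le> 2 * u l * v l + 0 * (v l)\<^sup>2"
    by (intro LIMSEQ_le_const) auto
  with neg[OF l ul1] show False by simp
qed

text \<open>The dichotomy is applied to the sets where \<open>p / |w|\<close> equals 1 and -1. A
  chain of points is an alternation. A separating polynomial \<open>R\<close> opposes
  \<open>p\<close> at every point of contact, so adding a small positive multiple of it stays within
  the bound, and the coefficient of degree \<open>n\<close> grows because \<open>R\<close> is
  monic.\<close>

lemma no_alternation_imp_improvable:
  fixes p :: "complex poly" and w :: "real \<Rightarrow> real"
  assumes K: "compact K" and w: "continuous_on K w" "\<And>y. y \<in> K \<Longrightarrow> w y \<noteq> 0"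
    and deg: "degree p \<le> n"
    and real: "\<And>y. y \<in> K \<Longrightarrow> poly p (of_real y) \<in> \<real>"
    and bound: "\<And>y. y \<in> K \<Longrightarrow> cmod (poly p (of_real y)) \<le> \<bar>w y\<bar>"
  shows "(\<exists>y :: nat \<Rightarrow> real. (\<forall>i j. i < j \<longrightarrow> j \<le> n \<longrightarrow> y i < y j) \<and> (\<forall>j\<le>n. y j \<in> K \<and>
            poly p (of_real (y j)) = (-1) ^ (n - j) * of_real \<bar>w (y j)\<bar>)) \<or>
         (\<exists>g. degree g \<le> n \<and> (\<forall>y\<in>K. cmod (poly g (of_real y)) \<le> \<bar>w y\<bar>) \<and>
            Re (coeff p n) < Re (coeff g n))"
proof -
  define P where "P y = Re (poly p (of_real y))" for y :: real
  define u where "u y = P y / \<bar>w y\<bar>" for y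
  have P: "poly p (of_real y) = of_real (P y)" if "y \<in> K" for y
    using real[OF that] by (auto simp: P_def elim: Reals_cases)
  have contP: "continuous_on K P" unfolding P_def by (intro continuous_intros)
  have contu: "continuous_on K u"
    unfolding u_def using w by (intro continuous_intros contP) auto
  have u_le: "\<bar>u y\<bar> \<le> 1" if "y \<in> K" for y
    using bound[OF that] w(2)[OF that] P[OF that] by (simp add: u_def abs_divide)
  define A where "A = K \<inter> u -` {1}"
  define B where "B = K \<inter> u -` {-1}"
  have "compact (K \<inter> u -` {c})" for c
    using compact_Int_closed[OF K continuous_closed_preimage[OF contu compact_imp_closed[OF K]],
        of "{c}"] by simp
  then have compact: "compact A" "compact B" unfolding A_def B_def by auto
  have "bdd_above A" using compact by (simp add: compact_imp_bounded bounded_imp_bdd_above)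
  then obtain m where "\<And>a. a \<in> A \<Longrightarrow> a \<le> m" by (auto simp: bdd_above_def)
  then have s: "\<forall>a\<in>A. a < m + 1" by force
  have disj: "A \<inter> B = {}" by (auto simp: A_def B_def)
  show ?thesis
    using alternating_points_or_separating_polynomial[OF compact disj s, of n]
  proof (elim disjE exE conjE)
    fix y :: "nat \<Rightarrow> real"
    assume mono: "\<forall>i j. i < j \<longrightarrow> j \<le> n \<longrightarrow> y i < y j"
      and mem: "\<forall>j\<le>n. y j \<in> (if even (n - j) then A else B)"
    have "y j \<in> K \<and> poly p (of_real (y j)) = (-1) ^ (n - j) * of_real \<bar>w (y j)\<bar>" if "j \<le> n" for j
    proof -
      have yK: "y j \<in> K" and "u (y j) = (-1) ^ (n - j)"
        using mem[rule_format, OF that] by (auto simp: A_def B_def split: if_splits)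
      then have "P (y j) = (-1) ^ (n - j) * \<bar>w (y j)\<bar>"
        using w(2)[OF yK] by (simp add: u_def divide_eq_eq)
      then show ?thesis using yK P[OF yK] by simp
    qed
    with mono show ?thesis by blast
  next
    fix R :: "real poly"
    assume R: "degree R = n" "lead_coeff R = 1" and neg: "\<forall>a\<in>A. poly R a < 0"
      and pos: "\<forall>b\<in>B. poly R b > 0"
    define v where "v y = poly R y / \<bar>w y\<bar>" for y
    have contv: "continuous_on K v"
      unfolding v_def using w by (intro continuous_intros) auto
    have uv: "u y * v y < 0" if "y \<in> K" "\<bar>u y\<bar> = 1" for y
    proof (cases "u y = 1")
      case True
      then have "poly R y < 0" using neg that by (auto simp: A_def)
      then show ?thesis using True w(2)[OF that(1)] by (simp add: v_def divide_neg_pos)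
    next
      case False
      then have *: "u y = -1" using that by auto
      then have "poly R y > 0" using pos that by (auto simp: B_def)
      then show ?thesis using * w(2)[OF that(1)] by (simp add: v_def)
    qed
    obtain \<epsilon> where \<epsilon>: "\<epsilon> > 0" and le: "\<And>y. y \<in> K \<Longrightarrow> \<bar>u y + \<epsilon> * v y\<bar> \<le> 1"
      using perturbation_decreases_norm[OF K contu contv u_le uv] by blast
    define g where "g = p + map_poly of_real (smult \<epsilon> R)"
    have "degree g \<le> n"
      unfolding g_def using deg R(1) \<epsilon> by (intro degree_add_le) (auto simp: degree_map_poly)
    moreover have "cmod (poly g (of_real y)) \<le> \<bar>w y\<bar>" if "y \<in> K" for y
    proof -
      have "poly (map_poly of_real Q) (of_real y) = complex_of_real (poly Q y)" for Q
        by (induction Q) (auto simp: map_poly_pCons)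
      then have "poly g (of_real y) = of_real (P y + \<epsilon> * poly R y)"
        using P[OF that] by (simp add: g_def)
      also have "P y + \<epsilon> * poly R y = (u y + \<epsilon> * v y) * \<bar>w y\<bar>"
        using w(2)[OF that] by (simp add: u_def v_def field_simps)
      finally have "poly g (of_real y) = of_real ((u y + \<epsilon> * v y) * \<bar>w y\<bar>)" .
      then have "cmod (poly g (of_real y)) = \<bar>u y + \<epsilon> * v y\<bar> * \<bar>w y\<bar>"
        by (simp add: norm_mult del: of_real_mult) (simp add: abs_mult)
      then show ?thesis using le[OF that] by (simp add: mult_left_le_one_le)
    qed
    moreover have "Re (coeff p n) < Re (coeff g n)"
      using R \<epsilon> by (simp add: g_def coeff_map_poly)
    ultimately show ?thesis by blast
  qed
qed

section \<open>Cyclic order and the coordinate at a base point\<close>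

text \<open>The orientation-preserving Moebius map taking the first argument to \<open>\<infinity>\<close>; its value at that
  point itself is junk.\<close>

fun coord :: "rs \<Rightarrow> rs \<Rightarrow> real" where
  "coord Infty (Fin z) = Re z"
| "coord Infty Infty = 0"
| "coord (Fin c) (Fin z) = 1 / (Re c - Re z)"
| "coord (Fin c) Infty = 0"

lemma xreal_ptsE:
  assumes "x \<in> xreal_pts"
  obtains (Fin) r :: real where "x = Fin (of_real r)" | (Infty) "x = Infty"
  using assms by (auto simp: xreal_pts_def)

text \<open>Such an \<open>f\<close> differs from \<open>coord xs\<close> by an
  orientation-preserving Moebius map fixing infinity, that is, by an increasing affine map. So the
  choice of \<open>f\<close> in \<open>cyc_ordered\<close> does not affect the order it
  induces.\<close>

lemma PSL2R_eq_affine_coord: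
  assumes f: "f \<in> PSL2R" "f xs = Infty" and xs: "xs \<in> xreal_pts"
  obtains \<alpha> \<beta> :: real where "\<alpha> > 0"
    "\<And>u. u \<in> xreal_pts - {xs} \<Longrightarrow> f u = Fin (of_real (\<alpha> * coord xs u + \<beta>))"
proof -
  obtain a b c d :: real where f_eq: "f = mobius a b c d" and det: "a * d - b * c = 1"
    using f(1) by (auto simp: PSL2R_def)
  show ?thesis using xs
  proof (cases rule: xreal_ptsE)
    case Infty
    with f(2) have c: "c = 0" by (auto simp: f_eq split: if_splits)
    with det have ad: "a * d = 1" by simp
    then have d: "d \<noteq> 0" by auto
    \<comment> \<open>The condition \<open>a * d = 1\<close> turns \<open>a / d\<close> into the
      square of \<open>a\<close>, and \<open>b / d\<close> into \<open>a * b\<close>.\<close>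
    show ?thesis
    proof (rule that[of "a\<^sup>2" "a * b"])
      show "a\<^sup>2 > 0" using ad by auto
      fix u assume "u \<in> xreal_pts - {xs}"
      then obtain r :: real where u: "u = Fin (of_real r)"
        using Infty by (auto simp: xreal_pts_def)
      have "(a * r + b) / d = a\<^sup>2 * r + a * b"
      proof -
        have "(a\<^sup>2 * r + a * b) * d = (a * d) * (a * r + b)" by algebra
        with d ad show ?thesis by (simp add: divide_eq_eq)
      qed
      then have "(of_real a * of_real r + of_real b) / of_real d = complex_of_real (a\<^sup>2 * r + a * b)"
        by (metis of_real_add of_real_divide of_real_mult)
      then show "f u = Fin (of_real (a\<^sup>2 * coord xs u + a * b))"
        using c d by (simp add: f_eq u Infty)
    qed
  next
    case (Fin s)
    have "complex_of_real (c * s + d) = 0"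
      using f(2) by (auto simp: f_eq Fin split: if_splits)
    then have d: "d = - c * s" by (simp only: of_real_eq_0_iff)
    have c: "c \<noteq> 0" using det d by auto
    have bs: "(b + a * s) * c = -1" using det d by (simp add: algebra_simps)
    \<comment> \<open>The constant \<open>a / c\<close> is the value of \<open>f\<close> at
      \<open>Infty\<close>, where the coordinate is 0; the factor of the coordinate comes from
      \<open>bs\<close>.\<close>
    show ?thesis
    proof (rule that[of "1 / c\<^sup>2" "a / c"])
      show "1 / c\<^sup>2 > 0" using c by simp
      fix u assume u: "u \<in> xreal_pts - {xs}"
      then have "u \<in> xreal_pts" by simp
      then show "f u = Fin (of_real (1 / c\<^sup>2 * coord xs u + a / c))"
      proof (cases rule: xreal_ptsE)
        case Infty
        then show ?thesis using c by (simp add: f_eq Fin)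
      next
        fix r :: real assume r: "u = Fin (of_real r)"
        have rs: "r \<noteq> s" using u r Fin by auto
        have "c * r + d \<noteq> 0" using c d rs by auto
        then have "complex_of_real (c * r + d) \<noteq> 0" by (simp only: of_real_eq_0_iff) simp
        moreover have "(a * r + b) / (c * r + d) = 1 / c\<^sup>2 * (1 / (s - r)) + a / c"
        proof -
          have "c\<^sup>2 * (s - r) * (a * r + b) = (c * r + d) * (1 + a * c * (s - r))"
            using bs unfolding d by algebra
          moreover have "1 / c\<^sup>2 * (1 / (s - r)) + a / c = (1 + a * c * (s - r)) / (c\<^sup>2 * (s - r))"
            using c rs by (simp add: field_simps power2_eq_square)
          ultimately show ?thesis using c rs \<open>c * r + d \<noteq> 0\<close>
            by (simp add: frac_eq_eq mult_ac)
        qed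
        then have "complex_of_real ((a * r + b) / (c * r + d)) = of_real (1 / c\<^sup>2 * (1 / (s - r)) + a / c)"
          by (rule arg_cong)
        ultimately show ?thesis by (simp add: f_eq Fin r)
      qed
    qed
  qed
qed

lemma PSL2R_coord:
  assumes "xs \<in> xreal_pts"
  obtains f where "f \<in> PSL2R" "f xs = Infty"
    "\<And>u. u \<in> xreal_pts - {xs} \<Longrightarrow> f u = Fin (of_real (coord xs u))"
  using assms
proof (cases rule: xreal_ptsE)
  case Infty
  show ?thesis
  proof (rule that[of "mobius 1 0 0 1"])
    show "mobius 1 0 0 1 \<in> PSL2R" unfolding PSL2R_def by force
  qed (auto simp: Infty xreal_pts_def)
next
  case (Fin s)
  show ?thesis
  proof (rule that[of "mobius 0 1 (-1) s"])
    show "mobius 0 1 (-1) s \<in> PSL2R" unfolding PSL2R_def by force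
    show "mobius 0 1 (-1) s xs = Infty" by (simp add: Fin)
    fix u assume "u \<in> xreal_pts - {xs}"
    then consider "u = Infty" | r where "u = Fin (of_real r)" "s \<noteq> r"
      using Fin by (auto elim!: xreal_ptsE)
    then show "mobius 0 1 (-1) s u = Fin (of_real (coord xs u))"
      by cases (auto simp: Fin)
  qed
qed

lemma inj_on_coord:
  assumes "xs \<in> xreal_pts"
  shows "inj_on (coord xs) (xreal_pts - {xs})"
  using assms
  by (cases rule: xreal_ptsE) (auto intro!: inj_onI elim!: xreal_ptsE)

text \<open>Increasing affine maps preserve sortedness, so some Moebius map sorts the points exactly
  when \<open>coord xs\<close> does. The bound 2 reflects the minimum length 3 of a cyclically
  ordered list.\<close>

lemma cyc_ordered_Cons_iff:
  assumes xs: "xs \<in> xreal_pts" and xl: "set xl \<subseteq> xreal_pts - {xs}"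
  shows "cyc_ordered (xs # xl) \<longleftrightarrow> 2 \<le> length xl \<and> sorted_wrt (<) (map (coord xs) xl)"
proof
  assume cyc: "cyc_ordered (xs # xl)"
  then obtain f where f: "f \<in> PSL2R" "f xs = Infty" "sorted_wrt xr_less (map f xl)"
    by (auto simp: cyc_ordered_def)
  obtain \<alpha> \<beta> :: real where "\<alpha> > 0"
    and f_eq: "\<And>u. u \<in> xreal_pts - {xs} \<Longrightarrow> f u = Fin (of_real (\<alpha> * coord xs u + \<beta>))"
    using PSL2R_eq_affine_coord[OF f(1,2) xs] by blast
  have less: "coord xs u < coord xs v" if "u \<in> set xl" "v \<in> set xl" "xr_less (f u) (f v)" for u v
    using that xl \<open>\<alpha> > 0\<close> by (auto simp: f_eq xr_less_def subset_iff simp flip: of_real_add of_real_mult)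
  have "sorted_wrt (<) (map (coord xs) xl)"
    unfolding sorted_wrt_map by (rule sorted_wrt_mono_rel[OF less f(3)[unfolded sorted_wrt_map]])
  with cyc show "2 \<le> length xl \<and> sorted_wrt (<) (map (coord xs) xl)"
    by (simp add: cyc_ordered_def)
next
  assume *: "2 \<le> length xl \<and> sorted_wrt (<) (map (coord xs) xl)"
  obtain f where f: "f \<in> PSL2R" "f xs = Infty"
    and f_eq: "\<And>u. u \<in> xreal_pts - {xs} \<Longrightarrow> f u = Fin (of_real (coord xs u))"
    using PSL2R_coord[OF xs] by blast
  have less: "xr_less (f u) (f v)" if "u \<in> set xl" "v \<in> set xl" "coord xs u < coord xs v" for u v
    using that xl by (auto simp: f_eq xr_less_def subset_iff)
  have "sorted_wrt xr_less (map f xl)"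
    unfolding sorted_wrt_map
    by (rule sorted_wrt_mono_rel[OF less *[THEN conjunct2, unfolded sorted_wrt_map]])
  moreover have "distinct xl"
    using * strict_sorted_iff[of "map (coord xs) xl"] by (simp add: distinct_map)
  ultimately show "cyc_ordered (xs # xl)"
    using * xl xs f by (auto simp: cyc_ordered_def)
qed

text \<open>Turns the arcs in the sign function into inequalities between coordinates.\<close>

lemma mem_xr_co_iff:
  assumes "xs \<in> xreal_pts" "x \<in> xreal_pts - {xs}" "c \<in> xreal_pts - {xs}"
  shows "x \<in> xr_co xs c \<longleftrightarrow> coord xs x < coord xs c"
  using assms cyc_ordered_Cons_iff[of xs "[x, c]"] by (auto simp: xr_co_def xr_oo_def)

text \<open>Compactness is defined through \<open>cayley\<close>, so \<open>coord xs\<close> is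
  factored as \<open>\<psi>\<close> after \<open>cayley\<close>; \<open>\<psi>\<close> is continuous
  on the image of \<open>E\<close> because \<open>xs\<close> lies outside \<open>E\<close>.\<close>

lemma compact_coord_image:
  assumes E: "xreal_compact E" and xs: "xs \<in> xreal_pts - E"
  shows "compact (coord xs ` E)"
proof -
  have EX: "E \<subseteq> xreal_pts" and comp: "compact (cayley ` E)"
    using E by (auto simp: xreal_compact_def)
  have nz: "complex_of_real r + \<i> \<noteq> 0" for r
    by (auto simp: complex_eq_iff)
  from xs have "xs \<in> xreal_pts" by simp
  then show ?thesis
  proof (cases rule: xreal_ptsE)
    case Infty
    \<comment> \<open>The inverse Cayley map; its only singularity, at 1, is the image of
      \<open>Infty\<close>.\<close>
    define \<psi> where "\<psi> w = Re (\<i> * (1 + w) / (1 - w))" for w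
    have *: "cayley x \<noteq> 1 \<and> \<psi> (cayley x) = coord xs x" if "x \<in> E" for x
    proof -
      have "x \<in> xreal_pts" "x \<noteq> Infty" using EX xs that Infty by auto
      then obtain r :: real where x: "x = Fin (of_real r)" by (auto elim: xreal_ptsE)
      have eq: "1 - cayley x = 2 * \<i> / (of_real r + \<i>)" "1 + cayley x = 2 * of_real r / (of_real r + \<i>)"
        using nz[of r] by (simp_all add: x field_simps)
      then have "1 - cayley x \<noteq> 0" using nz[of r] by simp
      moreover have "\<psi> (cayley x) = r"
        unfolding \<psi>_def eq using nz[of r] by simp
      ultimately show ?thesis by (simp add: x Infty)
    qed
    have "continuous_on (cayley ` E) \<psi>"
      unfolding \<psi>_def using * by (intro continuous_intros) auto
    moreover have "coord xs ` E = \<psi> ` cayley ` E"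
      using * by (force simp: image_image)
    ultimately show ?thesis using comp by (simp add: compact_continuous_image)
  next
    case (Fin s)
    \<comment> \<open>The inverse Cayley map followed by \<open>1 / (s - r)\<close>, with the inner
      fraction cleared so that the formula also covers the image 1 of \<open>Infty\<close>, where it
      gives 0.\<close>
    define \<psi> where "\<psi> w = Re ((1 - w) / (of_real s * (1 - w) - \<i> * (1 + w)))" for w
    have *: "of_real s * (1 - cayley x) - \<i> * (1 + cayley x) \<noteq> 0 \<and> \<psi> (cayley x) = coord xs x"
      if "x \<in> E" for x
    proof -
      have "x \<in> xreal_pts" using EX that by auto
      then show ?thesis
      proof (cases rule: xreal_ptsE)
        case Infty
        then show ?thesis by (simp add: \<psi>_def Fin)
      next
        fix r :: real assume x: "x = Fin (of_real r)"
        have rs: "r \<noteq> s" using xs that Fin x by auto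
        define k where "k = 2 * \<i> / (of_real r + \<i>)"
        have k: "k \<noteq> 0" using nz[of r] by (simp add: k_def)
        have eq: "1 - cayley x = k" and eq': "1 + cayley x = 2 * of_real r / (of_real r + \<i>)"
          using nz[of r] by (simp_all add: x k_def field_simps)
        have den: "of_real s * (1 - cayley x) - \<i> * (1 + cayley x) = k * of_real (s - r)"
          unfolding eq eq' by (simp add: k_def algebra_simps diff_divide_distrib)
        have "\<psi> (cayley x) = Re (of_real (1 / (s - r)))"
          unfolding \<psi>_def den unfolding eq using k by simp
        then show ?thesis using den rs k by (simp add: x Fin del: of_real_diff)
      qed
    qed
    have "continuous_on (cayley ` E) \<psi>"
      unfolding \<psi>_def using * by (intro continuous_intros) auto
    moreover have "coord xs ` E = \<psi> ` cayley ` E"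
      using * by (force simp: image_image)
    ultimately show ?thesis using comp by (simp add: compact_continuous_image)
  qed
qed

section \<open>Rational functions with bounded polar divisor\<close>

lemma reduced_rep:
  shows rden_nonzero: "rden F \<noteq> 0"
    and coprime_rnum_rden: "coprime (rnum F) (rden F)"
    and Fract_rnum_rden: "Fract (rnum F) (rden F) = F"
proof -
  obtain p q where "quot_of_fract F = (p, q)" by force
  then have "q \<noteq> 0 \<and> coprime p q \<and> F = Fract p q"
    using snd_quot_of_fract_nonzero[of F] coprime_quot_of_fract[of F] Fract_quot_of_fract[of F] by auto
  then have "\<exists>x. (case x of (p, q) \<Rightarrow> q \<noteq> 0 \<and> coprime p q \<and> F = Fract p q)" by auto
  from someI_ex[OF this] have "case reduced_rep F of (p, q) \<Rightarrow> q \<noteq> 0 \<and> coprime p q \<and> F = Fract p q"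
    by (simp add: reduced_rep_def)
  then show "rden F \<noteq> 0" "coprime (rnum F) (rden F)" "Fract (rnum F) (rden F) = F"
    by (auto simp: rnum_def rden_def split: prod.splits)
qed

text \<open>Cross-multiplication and coprimality show that \<open>rden F\<close> divides
  \<open>q\<close>. This is how values and degrees computed from an arbitrary fraction are compared
  with those of the chosen one.\<close>

lemma Fract_multiple_of_reduced:
  assumes "q \<noteq> 0" and F: "F = Fract p q"
  obtains h where "h \<noteq> 0" "p = rnum F * h" "q = rden F * h"
proof -
  have "Fract (rnum F) (rden F) = Fract p q" unfolding Fract_rnum_rden by (rule F)
  then have cross: "rnum F * q = p * rden F"
    using assms(1) rden_nonzero[of F] by (simp add: eq_fract)
  then have "rden F dvd rnum F * q" by simp
  then have "rden F dvd q"
    using coprime_dvd_mult_right_iff[of "rden F" "rnum F" q] coprime_rnum_rden[of F]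
    by (simp add: coprime_commute)
  then obtain h where h: "q = rden F * h" by auto
  have "rden F * p = rden F * (rnum F * h)" using cross unfolding h by (simp only: mult_ac)
  then have "p = rnum F * h" using rden_nonzero[of F] mult_left_cancel by blast
  with h assms(1) show ?thesis by (intro that) auto
qed

lemma rval_Fract:
  assumes "poly q z \<noteq> 0"
  shows "rval (Fract p q) (Fin z) = poly p z / poly q z"
proof -
  define F where "F = Fract p q"
  have "q \<noteq> 0" using assms by auto
  then obtain h where "p = rnum F * h" "q = rden F * h"
    using F_def by (rule Fract_multiple_of_reduced)
  with assms show ?thesis unfolding F_def[symmetric] by simp
qed

text \<open>Where neither denominator vanishes, equal values give zeros of the cross difference
  \<open>h\<close>. Discarding the finitely many poles, where \<open>rval\<close> is a default
  value, still leaves infinitely many of them.\<close>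

lemma ratfun_eqI:
  assumes "infinite X" "\<And>z. z \<in> X \<Longrightarrow> rval F (Fin z) = rval G (Fin z)"
  shows "F = G"
proof -
  define h where "h = rnum F * rden G - rnum G * rden F"
  have "finite {z. poly (rden F * rden G) z = 0}"
    by (intro poly_roots_finite) (simp add: rden_nonzero)
  then have inf: "infinite (X - {z. poly (rden F * rden G) z = 0})" using assms(1) by simp
  have "poly h z = 0" if "z \<in> X - {z. poly (rden F * rden G) z = 0}" for z
    using that assms(2)[of z] by (auto simp: h_def field_simps)
  then have "X - {z. poly (rden F * rden G) z = 0} \<subseteq> {z. poly h z = 0}" by auto
  with inf have "h = 0" using poly_roots_finite finite_subset by metis
  then have "Fract (rnum F) (rden F) = Fract (rnum G) (rden G)"
    by (simp add: h_def eq_fract rden_nonzero)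
  then show ?thesis by (simp add: Fract_rnum_rden)
qed

definition fin_supp :: "(rs \<Rightarrow> int) \<Rightarrow> complex set" where
  "fin_supp D = {c. D (Fin c) \<noteq> 0}"

text \<open>The common denominator for \<open>LL D\<close>. The multiplicity at \<open>Infty\<close>
  leaves no factor here; it is the amount by which the degree falls short of
  \<open>div_deg D\<close>.\<close>

definition pole_poly :: "(rs \<Rightarrow> int) \<Rightarrow> complex poly" where
  "pole_poly D = (\<Prod>c\<in>fin_supp D. [:- c, 1:] ^ nat (D (Fin c)))"

lemma finite_fin_supp: "integral_div D \<Longrightarrow> finite (fin_supp D)"
  unfolding fin_supp_def integral_div_def divisor_def
  using finite_vimageI[of "{z. D z \<noteq> 0}" Fin] by (auto simp: inj_def vimage_def)

lemma supp_eq: "{z. D z \<noteq> 0} = Fin ` fin_supp D \<union> (if D Infty \<noteq> 0 then {Infty} else {})"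
proof -
  have "D z \<noteq> 0 \<longleftrightarrow> z \<in> Fin ` fin_supp D \<union> (if D Infty \<noteq> 0 then {Infty} else {})" for z
    by (cases z) (auto simp: fin_supp_def)
  then show ?thesis by blast
qed

context
  fixes D :: "rs \<Rightarrow> int"
  assumes D: "integral_div D"
begin

lemma D_nonneg: "D z \<ge> 0" using D by (simp add: integral_div_def)

lemma pole_poly_nonzero: "pole_poly D \<noteq> 0"
  using finite_fin_supp[OF D] by (auto simp: pole_poly_def prod_zero_iff)

lemma lead_coeff_pole_poly: "lead_coeff (pole_poly D) = 1"
  by (simp add: pole_poly_def lead_coeff_prod lead_coeff_power)

lemma degree_pole_poly: "div_deg D = int (degree (pole_poly D) + nat (D Infty))"
proof -
  have "degree (pole_poly D) = (\<Sum>c\<in>fin_supp D. nat (D (Fin c)))"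
    unfolding pole_poly_def by (subst degree_prod_sum_eq) (auto simp: degree_power_eq)
  then have "int (degree (pole_poly D)) = (\<Sum>c\<in>fin_supp D. D (Fin c))"
    using D_nonneg by simp
  moreover have "div_deg D = (\<Sum>z\<in>Fin ` fin_supp D. D z) + D Infty"
    unfolding div_deg_def supp_eq using finite_fin_supp[OF D]
    by (subst sum.union_disjoint) auto
  ultimately show ?thesis using D_nonneg by (simp add: sum.reindex inj_on_def)
qed

lemma poly_pole_poly_eq_0_iff: "poly (pole_poly D) z = 0 \<longleftrightarrow> D (Fin z) \<noteq> 0"
  using finite_fin_supp[OF D] D_nonneg[of "Fin z"]
  by (auto simp: pole_poly_def poly_prod prod_zero_iff fin_supp_def)

lemma order_pole_poly: "int (order z (pole_poly D)) = D (Fin z)"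
proof (cases "z \<in> fin_supp D")
  case True
  have "pole_poly D = [:- z, 1:] ^ nat (D (Fin z)) *
      (\<Prod>c\<in>fin_supp D - {z}. [:- c, 1:] ^ nat (D (Fin c)))" (is "_ = _ * ?r")
    unfolding pole_poly_def using True finite_fin_supp[OF D] by (simp add: prod.remove)
  moreover have "poly ?r z \<noteq> 0"
    using finite_fin_supp[OF D] by (auto simp: poly_prod prod_zero_iff)
  ultimately show ?thesis
    using pole_poly_nonzero D_nonneg[of "Fin z"]
    by (simp add: order_mult order_power_n_n order_0I)
next
  case False
  then show ?thesis
    using poly_pole_poly_eq_0_iff[of z] by (simp add: fin_supp_def order_0I)
qed

text \<open>Over the complex numbers \<open>q\<close> is a constant times linear factors, so
  divisibility can be checked root by root.\<close>

lemma dvd_pole_polyI: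
  assumes "q \<noteq> 0" "\<And>z. int (order z q) \<le> D (Fin z)"
  shows "q dvd pole_poly D"
proof -
  have roots: "{z. poly q z = 0} \<subseteq> fin_supp D"
  proof safe
    fix z assume "poly q z = 0"
    then have "order z q \<noteq> 0" using assms(1) by (simp add: order_root)
    then show "z \<in> fin_supp D" using assms(2)[of z] by (simp add: fin_supp_def)
  qed
  have "(\<Prod>z\<in>{z. poly q z = 0}. [:-z, 1:] ^ order z q) dvd
      (\<Prod>z\<in>{z. poly q z = 0}. [:-z, 1:] ^ nat (D (Fin z)))"
    using assms(2) by (intro prod_dvd_prod le_imp_power_dvd) (simp add: le_nat_iff D_nonneg)
  also have "\<dots> dvd pole_poly D"
    unfolding pole_poly_def using roots finite_fin_supp[OF D] by (intro prod_dvd_prod_subset)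
  finally show ?thesis
    using assms(1) by (subst complex_poly_decompose[symmetric]) (simp add: smult_dvd_iff)
qed

text \<open>The bounds at finite points say that the reduced denominator divides
  \<open>pole_poly D\<close>. After expanding by the cofactor, the bound at \<open>Infty\<close>
  becomes the degree bound, since \<open>n\<close> is the degree of \<open>pole_poly D\<close> plus
  \<open>D Infty\<close>.\<close>

lemma LL_iff:
  assumes n: "div_deg D = int n"
  shows "F \<in> LL D \<longleftrightarrow> (\<exists>P. degree P \<le> n \<and> F = Fract P (pole_poly D))"
proof
  assume F: "F \<in> LL D"
  have ord: "int (order z (rden F)) \<le> D (Fin z)" for z
    using F by (auto simp: LL_def dest: spec[of _ "Fin z"])
  have inf: "int (degree (rnum F) - degree (rden F)) \<le> D Infty"
    using F by (auto simp: LL_def dest: spec[of _ Infty])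
  obtain h where h: "pole_poly D = rden F * h"
    using dvd_pole_polyI[OF rden_nonzero ord] by (auto elim: dvdE)
  have h0: "h \<noteq> 0" using h pole_poly_nonzero by auto
  have "degree (rnum F * h) \<le> n"
  proof (cases "rnum F = 0")
    case False
    have "degree (pole_poly D) = degree (rden F) + degree h"
      using h0 rden_nonzero[of F] by (simp add: h degree_mult_eq)
    then show ?thesis
      using False h0 n degree_pole_poly inf by (simp add: degree_mult_eq)
  qed simp
  moreover have "F = Fract (rnum F * h) (pole_poly D)"
    using h0 rden_nonzero[of F] unfolding h
    by (subst Fract_rnum_rden[of F, symmetric]) (simp add: eq_fract del: Fract_rnum_rden)
  ultimately show "\<exists>P. degree P \<le> n \<and> F = Fract P (pole_poly D)" by blast
next
  assume "\<exists>P. degree P \<le> n \<and> F = Fract P (pole_poly D)"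
  then obtain P where P: "degree P \<le> n" "F = Fract P (pole_poly D)" by auto
  obtain h where h: "h \<noteq> 0" "P = rnum F * h" "pole_poly D = rden F * h"
    by (rule Fract_multiple_of_reduced[OF pole_poly_nonzero P(2)])
  have "int (polar_div F x) \<le> D x" for x
  proof (cases x)
    case (Fin z)
    have "order z (rden F) \<le> order z (pole_poly D)"
      by (rule dvd_imp_order_le[OF pole_poly_nonzero]) (simp add: h(3))
    then show ?thesis using order_pole_poly[of z] by (simp add: Fin)
  next
    case Infty
    show ?thesis
    proof (cases "rnum F = 0")
      case True
      then show ?thesis using D_nonneg by (simp add: Infty)
    next
      case False
      have "degree (pole_poly D) = degree (rden F) + degree h"
        using h(1) rden_nonzero[of F] unfolding h(3) by (simp add: degree_mult_eq)
      moreover have "degree P = degree (rnum F) + degree h"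
        using h(1) False unfolding h(2) by (simp add: degree_mult_eq)
      ultimately show ?thesis
        using P(1) n degree_pole_poly D_nonneg[of Infty] by (simp add: Infty)
    qed
  qed
  then show "F \<in> LL D" by (simp add: LL_def)
qed

text \<open>With no pole allowed at infinity, \<open>pole_poly D\<close> is monic of degree exactly
  \<open>n\<close>, so the value is the ratio of the coefficients of degree \<open>n\<close>,
  including 0 when \<open>P\<close> has smaller degree.\<close>

lemma rval_Infty:
  assumes n: "div_deg D = int n" and P: "degree P \<le> n" and "D Infty = 0"
  shows "rval (Fract P (pole_poly D)) Infty = coeff P n"
proof -
  define F where "F = Fract P (pole_poly D)"
  obtain h where h: "h \<noteq> 0" "P = rnum F * h" "pole_poly D = rden F * h"
    by (rule Fract_multiple_of_reduced[OF pole_poly_nonzero F_def])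
  have dq: "degree (pole_poly D) = n" using degree_pole_poly n assms(3) by simp
  have dq': "n = degree (rden F) + degree h"
    using h(1) rden_nonzero[of F] unfolding dq[symmetric] h(3) by (simp add: degree_mult_eq)
  have lq: "lead_coeff (rden F) * lead_coeff h = 1"
    using lead_coeff_pole_poly unfolding h(3) lead_coeff_mult .
  show ?thesis
  proof (cases "rnum F = 0")
    case True
    then show ?thesis using h(2) unfolding F_def[symmetric] by simp
  next
    case False
    then have dP: "degree P = degree (rnum F) + degree h"
      using h(1) unfolding h(2) by (simp add: degree_mult_eq)
    have lP: "lead_coeff P = lead_coeff (rnum F) * lead_coeff h"
      unfolding h(2) lead_coeff_mult ..
    show ?thesis
    proof (cases "degree (rnum F) = degree (rden F)")
      case True
      then have "coeff P n = lead_coeff (rnum F) * lead_coeff h" using lP dP dq' by simp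
      also have "\<dots> = lead_coeff (rnum F) / lead_coeff (rden F)"
        using lq rden_nonzero[of F] by (simp add: field_simps)
      finally show ?thesis using True unfolding F_def[symmetric] by simp
    next
      case False
      then have "degree P < n" using dP dq' P by simp
      then show ?thesis using False unfolding F_def[symmetric] by (simp add: coeff_eq_0)
    qed
  qed
qed

end

section \<open>Reversed polynomials and behaviour at infinity\<close>

definition rev_poly :: "nat \<Rightarrow> 'a::comm_semiring_1 poly \<Rightarrow> 'a poly" where
  "rev_poly n p = (\<Sum>i\<le>n. monom (coeff p i) (n - i))"

lemma coeff_rev_poly: "coeff (rev_poly n p) k = (if k \<le> n then coeff p (n - k) else 0)"
proof -
  have "coeff (rev_poly n p) k = (\<Sum>i\<le>n. if i = n - k \<and> k \<le> n then coeff p i else 0)"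
    unfolding rev_poly_def coeff_sum by (intro sum.cong) auto
  also have "\<dots> = (if k \<le> n then coeff p (n - k) else 0)" by (simp add: sum.delta')
  finally show ?thesis .
qed

lemma degree_rev_poly_le: "degree (rev_poly n p) \<le> n"
  by (rule degree_le) (simp add: coeff_rev_poly)

text \<open>Reversal with respect to the fixed \<open>n\<close> rather than the actual degree stays
  an involution even when the constant term vanishes.\<close>

lemma rev_poly_rev_poly: "degree p \<le> n \<Longrightarrow> rev_poly n (rev_poly n p) = p"
  by (rule poly_eqI) (auto simp: coeff_rev_poly coeff_eq_0)

lemma poly_rev_poly:
  fixes p :: "'a::field poly"
  assumes "degree p \<le> n" "y \<noteq> 0"
  shows "poly (rev_poly n p) y = y ^ n * poly p (1 / y)"
proof -
  have "poly (rev_poly n p) y = (\<Sum>i\<le>n. coeff p i * y ^ (n - i))"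
    by (simp add: rev_poly_def poly_sum poly_monom)
  also have "\<dots> = (\<Sum>i\<le>n. y ^ n * (coeff p i * (1 / y) ^ i))"
    using assms(2) by (intro sum.cong) (auto simp: power_diff field_simps)
  also have "\<dots> = y ^ n * poly p (1 / y)"
    unfolding sum_distrib_left[symmetric]
    by (subst (2) poly_as_sum_of_monoms'[OF assms(1), symmetric]) (simp add: poly_sum poly_monom)
  finally show ?thesis .
qed

text \<open>The quotient is \<open>rev_poly n p\<close> at \<open>1 / z\<close>, and the constant
  term of the reversal is \<open>coeff p n\<close>.\<close>

lemma poly_over_power_tendsto_coeff:
  fixes p :: "complex poly"
  assumes "degree p \<le> n"
  shows "((\<lambda>z. poly p z / z ^ n) \<longlongrightarrow> coeff p n) at_infinity"
proof -
  have "((\<lambda>z. poly (rev_poly n p) (inverse z)) \<longlongrightarrow> poly (rev_poly n p) 0) at_infinity"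
    by (intro tendsto_intros tendsto_inverse_0)
  moreover have "\<forall>\<^sub>F z in at_infinity. poly (rev_poly n p) (inverse z) = poly p z / z ^ n"
    using eventually_not_equal_at_infinity[of 0]
    by eventually_elim (simp add: poly_rev_poly[OF assms] field_simps)
  ultimately show ?thesis
    by (auto simp: poly_0_coeff_0 coeff_rev_poly intro: Lim_transform_eventually)
qed

section \<open>Representation by a polynomial over a fixed real weight\<close>

definition weight :: "(rs \<Rightarrow> int) \<Rightarrow> rs \<Rightarrow> real \<Rightarrow> real" where
  "weight D xs y = (\<Prod>c\<in>{c. D c \<noteq> 0} - {xs}. (y - coord xs c) ^ nat (D c))"

text \<open>A factor has sign \<open>(-1) ^ nat (D c)\<close> when the point lies left of the pole
  \<open>c\<close> in the coordinate and is positive otherwise; the poles of the first kind are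
  those that \<open>sign_fun\<close> counts. No factor vanishes, because \<open>coord xs\<close> is
  injective away from \<open>xs\<close>.\<close>

lemma weight_sign:
  assumes D: "integral_div D" and supp: "{z. D z \<noteq> 0} \<subseteq> xreal_pts"
    and xs: "xs \<in> xreal_pts" and x: "x \<in> xreal_pts - {xs}" "D x = 0"
  shows "weight D xs (coord xs x) \<noteq> 0"
    and "weight D xs (coord xs x) = (-1) powi (sign_fun D xs x) * \<bar>weight D xs (coord xs x)\<bar>"
proof -
  let ?S = "{c. D c \<noteq> 0} - {xs}"
  have fin: "finite ?S" using D by (simp add: integral_div_def divisor_def)
  have D0: "D z \<ge> 0" for z using D by (simp add: integral_div_def)
  have ne: "coord xs x \<noteq> coord xs c" if "c \<in> ?S" for c
    using inj_onD[OF inj_on_coord[OF xs], of x c] that x supp by auto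
  then show "weight D xs (coord xs x) \<noteq> 0"
    unfolding weight_def using fin by (auto simp: prod_zero_iff)
  define e where "e c = (if coord xs x < coord xs c then nat (D c) else 0)" for c
  have "weight D xs (coord xs x) = (\<Prod>c\<in>?S. (-1) ^ e c * \<bar>(coord xs x - coord xs c) ^ nat (D c)\<bar>)"
    unfolding weight_def
  proof (intro prod.cong refl)
    fix c
    show "(coord xs x - coord xs c) ^ nat (D c) = (-1) ^ e c * \<bar>(coord xs x - coord xs c) ^ nat (D c)\<bar>"
      by (auto simp: e_def abs_if power_mult_distrib[symmetric] zero_le_power not_less
          simp flip: power_abs)
  qed
  also have "\<dots> = (-1) ^ (\<Sum>c\<in>?S. e c) * \<bar>weight D xs (coord xs x)\<bar>"
    by (simp add: prod.distrib power_sum weight_def abs_prod)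
  also have "(-1 :: real) ^ (\<Sum>c\<in>?S. e c) = (-1) powi int (\<Sum>c\<in>?S. e c)"
    by (simp only: power_int_of_nat)
  also have "int (\<Sum>c\<in>?S. e c) = sign_fun D xs x"
    unfolding sign_fun_def of_nat_sum
    using mem_xr_co_iff[OF xs x(1)] supp D0 by (intro sum.cong) (auto simp: e_def)
  finally show "weight D xs (coord xs x) = (-1) powi (sign_fun D xs x) * \<bar>weight D xs (coord xs x)\<bar>" .
qed

text \<open>In the coordinate sending \<open>xs\<close> to \<open>\<infinity>\<close>, \<open>F\<close> is \<open>p\<close> over the monic polynomial with
  the remaining prescribed poles, and the normalised limit of \<open>F\<close> at \<open>xs\<close> becomes the
  coefficient of degree \<open>n\<close> of \<open>p\<close>.\<close>

definition represents :: "(rs \<Rightarrow> int) \<Rightarrow> rs \<Rightarrow> nat \<Rightarrow> ratfun \<Rightarrow> complex poly \<Rightarrow> bool" where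
  "represents D xs n F p \<longleftrightarrow> degree p \<le> n \<and> lead_lim F xs (nat (D xs)) = coeff p n \<and>
     (\<forall>x\<in>xreal_pts - {xs}. D x = 0 \<longrightarrow>
        rval F x = poly p (of_real (coord xs x)) / of_real (weight D xs (coord xs x)))"

text \<open>Here the coordinate is the identity on real points and the weight is
  \<open>pole_poly D\<close>, so \<open>P\<close> needs no change. For the limit, numerator and
  denominator are divided by powers of \<open>z\<close> whose exponents differ by
  \<open>D Infty\<close>.\<close>

lemma represents_Infty:
  assumes D: "integral_div D" and n: "div_deg D = int n" and supp: "{z. D z \<noteq> 0} \<subseteq> xreal_pts"
    and P: "degree P \<le> n"
  shows "represents D Infty n (Fract P (pole_poly D)) P"
  unfolding represents_def
proof (intro conjI P ballI impI)
  let ?q = "pole_poly D"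
  have n_eq: "n = degree ?q + nat (D Infty)" using degree_pole_poly[OF D] unfolding n by (simp only: of_nat_eq_iff)
  have "((\<lambda>z. (poly P z / z ^ n) / (poly ?q z / z ^ degree ?q)) \<longlongrightarrow> coeff P n / 1) at_infinity"
    using poly_over_power_tendsto_coeff[OF P] poly_over_power_tendsto_coeff[of ?q "degree ?q"]
    by (intro tendsto_divide) (simp_all add: lead_coeff_pole_poly[OF D])
  moreover have "\<forall>\<^sub>F z in at_infinity. poly ?q z / z ^ degree ?q \<noteq> 0"
    using poly_over_power_tendsto_coeff[of ?q "degree ?q"]
    by (intro tendsto_imp_eventually_ne[where c = 1]) (simp_all add: lead_coeff_pole_poly[OF D])
  then have "\<forall>\<^sub>F z in at_infinity. (poly P z / z ^ n) / (poly ?q z / z ^ degree ?q) =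
      rval (Fract P ?q) (Fin z) / z ^ nat (D Infty)"
    using eventually_not_equal_at_infinity[of 0]
    by eventually_elim (simp add: rval_Fract n_eq power_add del: rval.simps)
  ultimately have "((\<lambda>z. rval (Fract P ?q) (Fin z) / z ^ nat (D Infty)) \<longlongrightarrow> coeff P n) at_infinity"
    by (auto intro: Lim_transform_eventually)
  then show "lead_lim (Fract P ?q) Infty (nat (D Infty)) = coeff P n"
    unfolding lead_lim.simps by (rule tendsto_Lim[OF trivial_limit_at_infinity])
  fix x assume x: "x \<in> xreal_pts - {Infty}" "D x = 0"
  then obtain r :: real where r: "x = Fin (of_real r)" by (auto elim: xreal_ptsE)
  have real: "of_real (Re c) = c" if "c \<in> fin_supp D" for c
    using that supp by (auto simp: fin_supp_def xreal_pts_def)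
  have S: "{c. D c \<noteq> 0} - {Infty} = Fin ` fin_supp D"
    by (subst supp_eq) auto
  have "weight D Infty r = (\<Prod>c\<in>fin_supp D. (r - Re c) ^ nat (D (Fin c)))"
    unfolding weight_def S by (simp add: prod.reindex inj_on_def)
  then have "of_real (weight D Infty r) = poly ?q (of_real r)"
    using real by (simp add: pole_poly_def poly_prod)
  moreover have "poly ?q (of_real r) \<noteq> 0"
    using poly_pole_poly_eq_0_iff[OF D] x r by simp
  ultimately show "rval (Fract P ?q) x =
      poly P (of_real (coord Infty x)) / of_real (weight D Infty (coord Infty x))"
    by (simp add: r rval_Fract del: rval.simps)
qed

text \<open>The factor of \<open>pole_poly D\<close> left after removing the zero at
  \<open>s\<close>; it is nonzero at \<open>s\<close> and supplies the constant in the limit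
  there.\<close>

definition other_poles_value :: "(rs \<Rightarrow> int) \<Rightarrow> complex \<Rightarrow> complex \<Rightarrow> complex" where
  "other_poles_value D s z = (\<Prod>c\<in>fin_supp D - {s}. (z - c) ^ nat (D (Fin c)))"

lemma poly_pole_poly_split:
  assumes "integral_div D"
  shows "poly (pole_poly D) z = (z - s) ^ nat (D (Fin s)) * other_poles_value D s z"
proof (cases "s \<in> fin_supp D")
  case True
  then show ?thesis
    using finite_fin_supp[OF assms]
    by (simp add: pole_poly_def other_poles_value_def poly_prod prod.remove)
next
  case False
  then show ?thesis
    by (simp add: pole_poly_def other_poles_value_def poly_prod fin_supp_def)
qed

lemma coeff_pcompose_reflect:
  fixes P :: "'a::idom poly"
  assumes "degree P \<le> n"
  shows "coeff (pcompose P [:s, -1:]) n = (-1) ^ n * coeff P n"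
proof (cases "degree P = n")
  case True
  then show ?thesis
    using lead_coeff_comp[of "[:s, -1:]" P] by (simp add: degree_pcompose)
next
  case False
  then show ?thesis using assms by (simp add: coeff_eq_0 degree_pcompose)
qed

text \<open>The substitution \<open>z = s - 1 / y\<close> inverts \<open>y = 1 / (s - z)\<close>.
  Multiplying numerator and denominator of \<open>P / pole_poly D\<close> by \<open>y ^ n\<close>
  gives the reversal of the reflected \<open>P\<close> over \<open>\<kappa>\<close> times the
  weight. Dividing by \<open>\<kappa>\<close> makes the denominator monic; its sign
  \<open>(-1) ^ d\<close> comes from the factors \<open>y * (z - s) = -1\<close>.\<close>

lemma represents_Fin:
  fixes s :: real
  assumes D: "integral_div D" and n: "div_deg D = int n" and supp: "{z. D z \<noteq> 0} \<subseteq> xreal_pts"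
    and P: "degree P \<le> n"
  defines "d \<equiv> nat (D (Fin (of_real s)))"
  defines "\<kappa> \<equiv> (-1) ^ d * other_poles_value D (of_real s) (of_real s)"
  shows "\<kappa> \<noteq> 0"
    and "represents D (Fin (of_real s)) n (Fract P (pole_poly D))
      (smult (1 / \<kappa>) (rev_poly n (pcompose P [:of_real s, -1:])))"
proof -
  let ?q = "pole_poly D" and ?s = "complex_of_real s"
  let ?S = "fin_supp D - {?s}"
  let ?P = "pcompose P [:?s, -1:]"
  have fin: "finite ?S" using finite_fin_supp[OF D] by simp
  show k0: "\<kappa> \<noteq> 0"
    using fin by (auto simp: \<kappa>_def other_poles_value_def prod_zero_iff)
  have degP: "degree ?P \<le> n" using P by (simp add: degree_pcompose)
  have D0: "D z \<ge> 0" for z using D by (simp add: integral_div_def)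
  have real: "of_real (Re c) = c" if "c \<in> fin_supp D" for c
    using that supp by (auto simp: fin_supp_def xreal_pts_def)
  have "n = degree ?q + nat (D Infty)" using degree_pole_poly[OF D] unfolding n by (simp only: of_nat_eq_iff)
  moreover have "degree ?q = (\<Sum>c\<in>fin_supp D. nat (D (Fin c)))"
    unfolding pole_poly_def by (subst degree_prod_sum_eq) (auto simp: degree_power_eq)
  moreover have "\<dots> = d + (\<Sum>c\<in>?S. nat (D (Fin c)))"
    using finite_fin_supp[OF D] unfolding d_def
    by (cases "?s \<in> fin_supp D") (auto simp: sum.remove fin_supp_def)
  ultimately have n_eq: "n = nat (D Infty) + (d + (\<Sum>c\<in>?S. nat (D (Fin c))))" by simp
  have S: "{c. D c \<noteq> 0} - {Fin ?s} = Fin ` ?S \<union> (if D Infty \<noteq> 0 then {Infty} else {})"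
    by (subst supp_eq) auto
  \<comment> \<open>The factor \<open>y ^ nat (D Infty)\<close> belongs to the pole at
    \<open>Infty\<close>, whose coordinate is 0.\<close>
  have weight: "weight D (Fin ?s) y =
      y ^ nat (D Infty) * (\<Prod>c\<in>?S. (y - 1 / (s - Re c)) ^ nat (D (Fin c)))" for y
    unfolding weight_def S using fin
    by (subst prod.union_disjoint) (auto simp: prod.reindex inj_on_def)
  \<comment> \<open>Multiplying by \<open>\<kappa>\<close> clears the denominators
    \<open>s - c\<close>, which brings the weight into the form that the substitution
    produces.\<close>
  have k_weight: "\<kappa> * of_real (weight D (Fin ?s) y) = of_real y ^ nat (D Infty) * (-1) ^ d *
      (\<Prod>c\<in>?S. ((?s - c) * of_real y - 1) ^ nat (D (Fin c)))" for y
  proof -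
    have "(?s - c) * of_real (y - 1 / (s - Re c)) = (?s - c) * of_real y - 1" if "c \<in> ?S" for c
    proof -
      have "?s - c = of_real (s - Re c)" "?s - c \<noteq> 0" using real[of c] that by auto
      then show ?thesis by (simp add: right_diff_distrib)
    qed
    then have "(\<Prod>c\<in>?S. (?s - c) ^ nat (D (Fin c))) *
        (\<Prod>c\<in>?S. of_real (y - 1 / (s - Re c)) ^ nat (D (Fin c))) =
        (\<Prod>c\<in>?S. ((?s - c) * of_real y - 1) ^ nat (D (Fin c)))"
      unfolding prod.distrib[symmetric] power_mult_distrib[symmetric] by (intro prod.cong) auto
    then show ?thesis
      unfolding weight \<kappa>_def other_poles_value_def of_real_mult of_real_power of_real_prod
      by (simp only: mult_ac)
  qed
  show "represents D (Fin ?s) n (Fract P ?q) (smult (1 / \<kappa>) (rev_poly n ?P))"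
    unfolding represents_def
  proof (intro conjI ballI impI)
    show "degree (smult (1 / \<kappa>) (rev_poly n ?P)) \<le> n"
      using degree_rev_poly_le order.trans[OF degree_smult_le] by blast
    have "\<forall>\<^sub>F z in at ?s. other_poles_value D ?s z \<noteq> 0"
      using k0 unfolding \<kappa>_def other_poles_value_def
      by (intro tendsto_imp_eventually_ne[where c = "other_poles_value D ?s ?s"])
         (auto simp: other_poles_value_def intro!: tendsto_intros)
    then have "\<forall>\<^sub>F z in at ?s. (-1) ^ d * poly P z / other_poles_value D ?s z =
        rval (Fract P ?q) (Fin z) * (?s - z) ^ d"
      using eventually_neq_at_within[of ?s ?s UNIV]
    proof eventually_elim
      case (elim z)
      then have "rval (Fract P ?q) (Fin z) = poly P z / ((z - ?s) ^ d * other_poles_value D ?s z)"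
        by (subst rval_Fract) (simp_all add: poly_pole_poly_split[OF D, of z ?s] d_def)
      moreover have "(?s - z) ^ d = (-1) ^ d * (z - ?s) ^ d"
        by (simp flip: power_mult_distrib)
      ultimately show ?case using elim by (simp add: field_simps del: rval.simps)
    qed
    moreover have "((\<lambda>z. (-1) ^ d * poly P z / other_poles_value D ?s z) \<longlongrightarrow>
        (-1) ^ d * poly P ?s / other_poles_value D ?s ?s) (at ?s)"
      using k0 unfolding other_poles_value_def
      by (intro tendsto_intros) (auto simp: \<kappa>_def other_poles_value_def)
    ultimately have "((\<lambda>z. rval (Fract P ?q) (Fin z) * (?s - z) ^ d) \<longlongrightarrow>
        (-1) ^ d * poly P ?s / other_poles_value D ?s ?s) (at ?s)"
      by (blast intro: Lim_transform_eventually)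
    then have "lead_lim (Fract P ?q) (Fin ?s) d = (-1) ^ d * poly P ?s / other_poles_value D ?s ?s"
      by (simp add: tendsto_Lim del: rval.simps)
    also have "\<dots> = poly P ?s / \<kappa>"
      using k0 by (simp add: \<kappa>_def field_simps flip: power_mult_distrib)
    also have "\<dots> = coeff (smult (1 / \<kappa>) (rev_poly n ?P)) n"
      by (simp add: coeff_rev_poly poly_pcompose flip: poly_0_coeff_0)
    finally show "lead_lim (Fract P ?q) (Fin ?s) (nat (D (Fin ?s))) =
        coeff (smult (1 / \<kappa>) (rev_poly n ?P)) n" unfolding d_def .
    fix x assume x: "x \<in> xreal_pts - {Fin ?s}" "D x = 0"
    define y where "y = coord (Fin ?s) x"
    have W0: "of_real (weight D (Fin ?s) y) \<noteq> (0 :: complex)"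
      using weight_sign(1)[OF D supp _ x] unfolding y_def by (auto simp: xreal_pts_def)
    from x have "x \<in> xreal_pts" by simp
    then have "rval (Fract P ?q) x = poly (rev_poly n ?P) (of_real y) / (\<kappa> * of_real (weight D (Fin ?s) y))"
    proof (cases rule: xreal_ptsE)
      case Infty
      \<comment> \<open>At \<open>y = 0\<close> the substitution breaks down, so the value is
        compared directly: numerator and denominator pick up the same sign
        \<open>(-1) ^ n\<close>.\<close>
      have "\<kappa> * of_real (weight D (Fin ?s) 0) = (-1) ^ n"
        using x(2) unfolding k_weight n_eq Infty by (simp add: power_add power_sum)
      moreover have "poly (rev_poly n ?P) 0 = (-1) ^ n * coeff P n"
        by (simp add: poly_0_coeff_0 coeff_rev_poly coeff_pcompose_reflect[OF P])
      ultimately show ?thesis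
        using rval_Infty[OF D n P] x(2) by (simp add: Infty y_def del: rval.simps)
    next
      case (Fin r)
      have rs: "r \<noteq> s" using x Fin by auto
      have y: "y = 1 / (s - r)" by (simp add: y_def Fin)
      have y0: "complex_of_real y \<noteq> 0" using rs by (simp add: y)
      have inv: "?s - 1 / of_real y = of_real r" by (simp add: y)
      have q0: "poly ?q (of_real r) \<noteq> 0"
        using poly_pole_poly_eq_0_iff[OF D] x(2) Fin by simp
      have yr: "of_real y * (of_real r - c) = (?s - c) * of_real y - 1" for c
        using rs by (simp add: y field_simps)
      have "of_real y ^ n * poly ?q (of_real r) = of_real y ^ nat (D Infty) *
          (of_real y * (of_real r - ?s)) ^ d * (\<Prod>c\<in>?S. (of_real y * (of_real r - c)) ^ nat (D (Fin c)))"
        unfolding poly_pole_poly_split[OF D, of _ ?s] n_eq other_poles_value_def d_def[symmetric]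
        by (simp add: power_add power_sum power_mult_distrib prod.distrib)
      also have "\<dots> = \<kappa> * of_real (weight D (Fin ?s) y)"
        unfolding k_weight yr by simp
      finally have "\<kappa> * of_real (weight D (Fin ?s) y) = of_real y ^ n * poly ?q (of_real r)" by simp
      moreover have "poly (rev_poly n ?P) (of_real y) = of_real y ^ n * poly P (of_real r)"
        using poly_rev_poly[OF degP y0] inv by (simp add: poly_pcompose)
      ultimately show ?thesis
        using y0 by (simp add: Fin rval_Fract[OF q0] del: rval.simps)
    qed
    then show "rval (Fract P ?q) x = poly (smult (1 / \<kappa>) (rev_poly n ?P)) (of_real (coord (Fin ?s) x)) /
        of_real (weight D (Fin ?s) (coord (Fin ?s) x))"
      by (simp add: y_def)
  qed
qed

lemma LL_imp_represents:
  assumes D: "integral_div D" and n: "div_deg D = int n" and supp: "{z. D z \<noteq> 0} \<subseteq> xreal_pts"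
    and xs: "xs \<in> xreal_pts" and F: "F \<in> LL D"
  obtains p where "represents D xs n F p"
proof -
  obtain P where P: "degree P \<le> n" "F = Fract P (pole_poly D)"
    using F LL_iff[OF D n] by auto
  from xs show ?thesis
  proof (cases rule: xreal_ptsE)
    case Infty
    then show ?thesis using that represents_Infty[OF D n supp P(1)] P(2) by blast
  next
    case (Fin r)
    then show ?thesis using that represents_Fin(2)[OF D n supp P(1)] P(2) by blast
  qed
qed

text \<open>For finite \<open>s\<close> the construction can be undone: the reflection of
  \<open>z\<close> to \<open>s - z\<close> and the reversal are involutions, and
  \<open>\<kappa>\<close> is a nonzero constant depending only on \<open>D\<close> and
  \<open>s\<close>.\<close>

lemma poly_imp_represents:
  assumes D: "integral_div D" and n: "div_deg D = int n" and supp: "{z. D z \<noteq> 0} \<subseteq> xreal_pts"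
    and xs: "xs \<in> xreal_pts" and p: "degree p \<le> n"
  obtains F where "F \<in> LL D" "represents D xs n F p"
  using xs
proof (cases rule: xreal_ptsE)
  case Infty
  then show ?thesis
    using that[of "Fract p (pole_poly D)"] represents_Infty[OF D n supp p] LL_iff[OF D n] p by blast
next
  case (Fin s)
  define \<kappa> where "\<kappa> = (-1) ^ nat (D (Fin (of_real s))) * other_poles_value D (of_real s) (of_real s)"
  \<comment> \<open>Since \<open>\<kappa>\<close> does not involve the polynomial, its nonvanishing
    is read off with the zero polynomial.\<close>
  have k0: "\<kappa> \<noteq> 0" unfolding \<kappa>_def by (rule represents_Fin(1)[OF D n supp, of 0]) simp
  define P where "P = pcompose (smult \<kappa> (rev_poly n p)) [:of_real s, -1:]"
  have degP: "degree P \<le> n"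
    unfolding P_def using degree_rev_poly_le[of n p] by (simp add: degree_pcompose)
  have "pcompose P [:of_real s, -1:] = smult \<kappa> (rev_poly n p)"
    unfolding P_def by (simp add: pcompose_assoc[symmetric] pcompose_pCons pcompose_idR)
  then have "rev_poly n (pcompose P [:of_real s, -1:]) = smult \<kappa> (rev_poly n (rev_poly n p))"
    by (simp add: poly_eq_iff coeff_rev_poly)
  then have "smult (1 / \<kappa>) (rev_poly n (pcompose P [:of_real s, -1:])) = p"
    using k0 rev_poly_rev_poly[OF p] by simp
  then have "represents D xs n (Fract P (pole_poly D)) p"
    using represents_Fin(2)[OF D n supp degP, of s] by (simp add: \<kappa>_def Fin)
  then show ?thesis using that[of "Fract P (pole_poly D)"] LL_iff[OF D n] degP by blast
qed

lemma infinite_regular_points: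
  assumes "integral_div D"
  shows "infinite {r :: real. D (Fin (of_real r)) = 0 \<and> Fin (of_real r) \<noteq> xs}"
proof -
  have "finite ({z. D z \<noteq> 0} \<union> {xs})" using assms by (simp add: integral_div_def divisor_def)
  then have "finite ((\<lambda>r :: real. Fin (of_real r)) -` ({z. D z \<noteq> 0} \<union> {xs}))"
    by (rule finite_vimageI) (simp add: inj_def)
  then have "infinite (UNIV - (\<lambda>r :: real. Fin (of_real r)) -` ({z. D z \<noteq> 0} \<union> {xs}))"
    by (rule Diff_infinite_finite[OF _ infinite_UNIV_char_0])
  then show ?thesis by (rule infinite_super[rotated]) auto
qed

text \<open>Transfers uniqueness from polynomials to functions: \<open>p\<close> prescribes the
  values at infinitely many real points.\<close>

lemma represents_inj:
  assumes D: "integral_div D" and "represents D xs n F p" "represents D xs n G p"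
  shows "F = G"
proof (rule ratfun_eqI)
  let ?R = "{r :: real. D (Fin (of_real r)) = 0 \<and> Fin (of_real r) \<noteq> xs}"
  show "infinite (complex_of_real ` ?R)"
    using infinite_regular_points[OF D] by (simp add: finite_image_iff inj_on_def)
  fix z assume "z \<in> complex_of_real ` ?R"
  then show "rval F (Fin z) = rval G (Fin z)"
    using assms(2,3) by (auto simp: represents_def xreal_pts_def simp del: rval.simps)
qed

text \<open>At regular real points \<open>p\<close> is the real weight times a real value of
  \<open>F\<close>, so \<open>p\<close> and its conjugate polynomial agree at infinitely many real
  coordinates and hence coincide.\<close>

lemma real_ratfun_imp_poly_real:
  assumes D: "integral_div D" and xs: "xs \<in> xreal_pts" and p: "represents D xs n F p"
    and F: "real_ratfun F" and supp: "{z. D z \<noteq> 0} \<subseteq> xreal_pts"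
  shows "poly p (of_real y) \<in> \<real>"
proof -
  let ?R = "{r :: real. D (Fin (of_real r)) = 0 \<and> Fin (of_real r) \<noteq> xs}"
  let ?f = "\<lambda>r :: real. coord xs (Fin (of_real r))"
  define h where "h = p - map_poly cnj p"
  have h: "poly h (of_real t) = poly p (of_real t) - cnj (poly p (of_real t))" for t
    using poly_cnj[of p "of_real t"] by (simp add: h_def)
  have "inj_on ?f ?R"
  proof (rule inj_onI)
    fix r t assume "r \<in> ?R" "t \<in> ?R" "?f r = ?f t"
    then have "Fin (complex_of_real r) = Fin (of_real t)"
      by (intro inj_onD[OF inj_on_coord[OF xs]]) (auto simp: xreal_pts_def)
    then show "r = t" by simp
  qed
  then have "inj_on (complex_of_real \<circ> ?f) ?R" by (rule comp_inj_on) (simp add: inj_on_def)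
  then have "infinite ((complex_of_real \<circ> ?f) ` ?R)"
    using infinite_regular_points[OF D, of xs] by (simp only: finite_image_iff not_False_eq_True)
  moreover have "poly h (of_real (?f r)) = 0" if "r \<in> ?R" for r
  proof -
    have x: "Fin (of_real r) \<in> xreal_pts - {xs}" "D (Fin (of_real r)) = 0"
      using that by (auto simp: xreal_pts_def)
    have "rval F (Fin (of_real r)) = cnj (rval F (Fin (of_real r)))"
      using F unfolding real_ratfun_def by (metis complex_cnj_complex_of_real)
    moreover have rval: "rval F (Fin (of_real r)) =
        poly p (of_real (?f r)) / of_real (weight D xs (?f r))"
      using p x unfolding represents_def by blast
    ultimately show ?thesis
      using weight_sign(1)[OF D supp xs x] unfolding h rval by simp
  qed
  then have "(complex_of_real \<circ> ?f) ` ?R \<subseteq> {z. poly h z = 0}" by auto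
  ultimately have "h = 0" using poly_roots_finite[of h] finite_subset by blast
  then have "poly p (of_real y) - cnj (poly p (of_real y)) = 0" using h[of y] by simp
  then show ?thesis unfolding Reals_cnj_iff by simp
qed

section \<open>Characterisation of extremal functions by alternation\<close>

theorem mainTheorem1:
  fixes E :: "rs set" and D :: "rs \<Rightarrow> int" and xs :: rs and n :: nat and F :: ratfun
  assumes E_compact: "xreal_compact E"
    and E_proper: "E \<noteq> xreal_pts"
    and E_infinite: "infinite E"
    and n_pos: "n \<ge> 1"
    and D_integral: "integral_div D"
    and D_deg: "div_deg D = int n"
    and D_supp: "{z. D z \<noteq> 0} \<subseteq> xreal_pts - E"
    and xs_in: "xs \<in> xreal_pts - E"
    and F_L: "F \<in> LL D"
    and F_real: "real_ratfun F"
    and F_norm: "norm_le1 E F"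
  shows "(extremal E D xs F \<longleftrightarrow>
            (\<exists>xl. length xl = n + 1 \<and> alternation_set E D xs F xl))
         \<and> (extremal E D xs F \<longrightarrow> (\<forall>G. extremal E D xs G \<longrightarrow> G = F))"
proof -
  let ?W = "weight D xs" and ?\<phi> = "coord xs"
  have xs: "xs \<in> xreal_pts" and supp: "{z. D z \<noteq> 0} \<subseteq> xreal_pts"
    using xs_in D_supp by auto
  have E: "x \<in> xreal_pts - {xs}" "D x = 0" if "x \<in> E" for x
    using that E_compact xs_in D_supp by (auto simp: xreal_compact_def)
  have W0: "?W (?\<phi> x) \<noteq> 0" if "x \<in> E" for x
    using weight_sign(1)[OF D_integral supp xs E[OF that]] .
  have val: "rval G x = poly g (of_real (?\<phi> x)) / of_real (?W (?\<phi> x))"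
    if "represents D xs n G g" "x \<in> E" for G g x
    using that E[of x] by (auto simp: represents_def simp del: rval.simps)
  have norm_iff: "norm_le1 E G \<longleftrightarrow> (\<forall>y\<in>?\<phi> ` E. cmod (poly g (of_real y)) \<le> \<bar>?W y\<bar>)"
    if "represents D xs n G g" for G g
    using W0 by (auto simp: norm_le1_def val[OF that] norm_divide simp del: rval.simps)
  obtain p where p: "represents D xs n F p"
    using LL_imp_represents[OF D_integral D_deg supp xs F_L] .
  then have degp: "degree p \<le> n" by (simp add: represents_def)
  \<comment> \<open>The sign of the weight, given by \<open>sign_fun\<close>, cancels the
    corresponding power of -1 in an alternation set. List positions start at 0, so position
    \<open>j\<close> is the index \<open>Suc j\<close> of that definition, and
    \<open>n + 1 - Suc j\<close> is \<open>n - j\<close>.\<close>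
  have alt_iff: "rval F x = (-1) powi (int (n + 1) - int (Suc j) - sign_fun D xs x) \<longleftrightarrow>
      poly p (of_real (?\<phi> x)) = (-1) ^ (n - j) * of_real \<bar>?W (?\<phi> x)\<bar>" if "x \<in> E" "j \<le> n" for x j
  proof -
    define s :: complex where "s = (-1) powi (sign_fun D xs x)"
    have s0: "s \<noteq> 0" by (simp add: s_def)
    have "of_real (?W (?\<phi> x)) = complex_of_real ((-1) powi (sign_fun D xs x) * \<bar>?W (?\<phi> x)\<bar>)"
      using weight_sign(2)[OF D_integral supp xs E[OF that(1)]] by (rule arg_cong)
    then have W: "of_real (?W (?\<phi> x)) = s * of_real \<bar>?W (?\<phi> x)\<bar>"
      by (simp add: s_def)
    have "(-1 :: complex) powi (int (n + 1) - int (Suc j) - sign_fun D xs x) =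
        (-1) powi (int (n - j)) / s"
      using that(2) unfolding s_def by (subst power_int_diff[symmetric]) (auto simp: of_nat_diff)
    also have "(-1 :: complex) powi (int (n - j)) = (-1) ^ (n - j)" by (rule power_int_of_nat)
    finally have pow: "(-1 :: complex) powi (int (n + 1) - int (Suc j) - sign_fun D xs x) =
        (-1) ^ (n - j) / s" .
    show ?thesis
      unfolding val[OF p that(1)] pow using s0 W0[OF that(1)] by (subst W) (simp add: field_simps)
  qed
  have lead: "lead_lim G xs (nat (D xs)) = coeff g n" and deg: "degree g \<le> n"
    if "represents D xs n G g" for G g
    using that by (simp_all add: represents_def)

  \<comment> \<open>\<open>G\<close> is any admissible function, real or not, so this yields both
    extremality and uniqueness among complex competitors.\<close>
  have sufficient: "Re (lead_lim G xs (nat (D xs))) \<le> Re (lead_lim F xs (nat (D xs))) \<and>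
      (Re (lead_lim G xs (nat (D xs))) = Re (lead_lim F xs (nat (D xs))) \<longrightarrow> G = F)"
    if xl: "length xl = n + 1" "alternation_set E D xs F xl" and G: "admissible E D G" for xl G
  proof -
    obtain g where g: "represents D xs n G g"
      using LL_imp_represents[OF D_integral D_deg supp xs] G by (auto simp: admissible_def)
    define y where "y j = ?\<phi> (xl ! j)" for j
    have xlE: "xl ! j \<in> E" if "j \<le> n" for j
      using that xl by (auto simp: alternation_set_def)
    have "set xl \<subseteq> xreal_pts - {xs}" using xl(2) E by (auto simp: alternation_set_def)
    then have "sorted_wrt (<) (map ?\<phi> xl)"
      using xl(2) cyc_ordered_Cons_iff[OF xs] by (simp add: alternation_set_def)
    then have mono: "y i < y j" if "i < j" "j \<le> n" for i j
      using that xl(1) unfolding y_def by (auto simp: sorted_wrt_iff_nth_less)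
    have alt: "poly p (of_real (y j)) = (-1) ^ (n - j) * of_real \<bar>?W (y j)\<bar>" if "j \<le> n" for j
    proof -
      have "Suc j \<in> {1..length xl}" using that xl(1) by simp
      then have "rval F (xl ! j) = (-1) powi (int (n + 1) - int (Suc j) - sign_fun D xs (xl ! j))"
        using xl unfolding alternation_set_def by (metis diff_Suc_1)
      then show ?thesis using alt_iff[OF xlE[OF that] that] by (simp only: y_def)
    qed
    have bound: "cmod (poly g (of_real (y j))) \<le> \<bar>?W (y j)\<bar>" if "j \<le> n" for j
      using norm_iff[OF g] G xlE[OF that] by (auto simp: y_def admissible_def)
    show ?thesis
      unfolding lead[OF g] lead[OF p]
      using alternation_imp_coeff_le[OF mono degp deg[OF g] alt bound]
        represents_inj[OF D_integral p, of G] g by blast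
  qed

  have necessary: "\<exists>xl. length xl = n + 1 \<and> alternation_set E D xs F xl" if "extremal E D xs F"
  proof -
    have "compact (?\<phi> ` E)" using compact_coord_image[OF E_compact xs_in] .
    moreover have "continuous_on (?\<phi> ` E) ?W" unfolding weight_def by (intro continuous_intros)
    ultimately have "(\<exists>y :: nat \<Rightarrow> real. (\<forall>i j. i < j \<longrightarrow> j \<le> n \<longrightarrow> y i < y j) \<and> (\<forall>j\<le>n. y j \<in> ?\<phi> ` E \<and>
            poly p (of_real (y j)) = (-1) ^ (n - j) * of_real \<bar>?W (y j)\<bar>)) \<or>
         (\<exists>g. degree g \<le> n \<and> (\<forall>y\<in>?\<phi> ` E. cmod (poly g (of_real y)) \<le> \<bar>?W y\<bar>) \<and>
            Re (coeff p n) < Re (coeff g n))"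
      using W0 degp real_ratfun_imp_poly_real[OF D_integral xs p F_real supp] norm_iff[OF p] F_norm
      by (intro no_alternation_imp_improvable) auto
    then show ?thesis
    proof (elim disjE exE conjE)
      fix g assume g: "degree g \<le> n" "\<forall>y\<in>?\<phi> ` E. cmod (poly g (of_real y)) \<le> \<bar>?W y\<bar>"
        "Re (coeff p n) < Re (coeff g n)"
      \<comment> \<open>The improving polynomial is turned back into an admissible function with a
        larger limit, which extremality excludes.\<close>
      obtain G where G: "G \<in> LL D" "represents D xs n G g"
        using poly_imp_represents[OF D_integral D_deg supp xs g(1)] .
      then have "admissible E D G" using norm_iff g(2) by (auto simp: admissible_def)
      then have "Re (coeff g n) \<le> Re (coeff p n)"
        using that unfolding extremal_def lead[OF G(2), symmetric] lead[OF p, symmetric] by blast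
      with g(3) show ?thesis by simp
    next
      fix y :: "nat \<Rightarrow> real"
      assume mono: "\<forall>i j. i < j \<longrightarrow> j \<le> n \<longrightarrow> y i < y j"
        and y: "\<forall>j\<le>n. y j \<in> ?\<phi> ` E \<and> poly p (of_real (y j)) = (-1) ^ (n - j) * of_real \<bar>?W (y j)\<bar>"
      then have "\<forall>j. \<exists>x. j \<le> n \<longrightarrow> x \<in> E \<and> y j = ?\<phi> x" by blast
      then obtain x where x: "\<And>j. j \<le> n \<Longrightarrow> x j \<in> E \<and> y j = ?\<phi> (x j)" by metis
      define xl where "xl = map x [0..<n + 1]"
      have len: "length xl = n + 1" and nth: "\<And>j. j \<le> n \<Longrightarrow> xl ! j = x j"
        by (simp_all add: xl_def del: upt_Suc)
      have sub: "set xl \<subseteq> E" using x by (auto simp: xl_def)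
      have "sorted_wrt (<) (map ?\<phi> xl)"
        using mono x by (auto simp: sorted_wrt_iff_nth_less len nth)
      \<comment> \<open>A cyclic order requires two points besides \<open>xs\<close>, which
        \<open>n_pos\<close> guarantees.\<close>
      then have cyc: "cyc_ordered (xs # xl)"
        using cyc_ordered_Cons_iff[OF xs, of xl] sub E len n_pos by auto
      have "rval F (xl ! (j - 1)) = (-1) powi (int (length xl) - int j - sign_fun D xs (xl ! (j - 1)))"
        if jn: "j \<in> {1..length xl}" for j
      proof -
        obtain i where j: "j = Suc i" and i: "i \<le> n" using jn len by (cases j) auto
        show ?thesis using alt_iff[of "x i" i] x[OF i] y[rule_format, OF i] i unfolding j
          by (simp add: nth len del: rval.simps)
      qed
      then have "alternation_set E D xs F xl"
        using sub cyc by (simp add: alternation_set_def cyc_ordered_def del: rval.simps)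
      with len show ?thesis by blast
    qed
  qed
  have F: "admissible E D F" using F_L F_norm by (simp add: admissible_def)
  have "extremal E D xs F" if "length xl = n + 1" "alternation_set E D xs F xl" for xl
    unfolding extremal_def using F sufficient[OF that] by blast
  \<comment> \<open>Extremality gives \<open>F\<close> an alternation set, and \<open>G\<close>
    attains the same limit, so the equality case of \<open>sufficient\<close> applies.\<close>
  moreover have "G = F" if FG: "extremal E D xs F" "extremal E D xs G" for G
  proof -
    obtain xl where "length xl = n + 1" "alternation_set E D xs F xl"
      using necessary[OF FG(1)] by blast
    moreover have "admissible E D G"
      "Re (lead_lim G xs (nat (D xs))) = Re (lead_lim F xs (nat (D xs)))"
      using FG unfolding extremal_def by (auto intro: antisym)
    ultimately show ?thesis using sufficient by blast
  qed
  ultimately show ?thesis using necessary by blast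
qed

end
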